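(* Let $\alpha,\beta,g_3,\delta$ be constants with $(\alpha,\beta)\neq(0,0)$ and $\delta\ne0$, and let $Y=\alpha w+\beta\big(w^3+\frac{g_3}2\big)$. Consider the maximally symmetric $(2,3,5)$-distribution in local coordinates $(w,y,z,p,q)$ given by the span of $$X^1=\partial_q,\qquad X^2=\frac{Y^2}{2(4w^3-g_3)}\partial_w+p\,\partial_y+q\,\partial_p+\frac{(4w^3-g_3)^3}{Y^4}q^2\,\partial_z,$$ which is annihilated by the 1-forms $$\omega_1=dy-\frac{2p}{Y^2}(4w^3-g_3)\,dw,\quad \omega_2=dp-\frac{2q}{Y^2}(4w^3-g_3)\,dw,\quad \omega_3=dz-\frac{2q^2}{Y^6}(4w^3-g_3)^4\,dw .$$ Then the vector fields $$\begin{aligned} S^1&=\Big(\frac{6\beta\delta^2Y^3}{(4w^3-g_3)^2}y+\frac{24\delta^2wY^2}{(4w^3-g_3)^2}p+\frac{12\delta^2(\alpha(8w^3+g_3)+9\beta g_3w^2)}{(4w^3-g_3)Y}q\Big)X^1-\frac{8\delta^2(4w^3-g_3)}{Y^2}X^2,\\ S^2&=\frac{Y^3}{4\delta(4w^3-g_3)^2}X^1,\\ S^3&=-c_1S^1+c_2S^2-c_3^2Z^1, \end{aligned}$$ where $$Z^1=-\frac{2\delta w}{Y}\partial_y+\frac{4\delta(4w^3-g_3)^2}{Y^3}q\,\partial_z+\frac{\delta(\beta(8w^3+g_3)+4\alpha w)}{2(4w^3-g_3)}\partial_p-\frac{12\delta Y^3w^2}{(4w^3-g_3)^3}\partial_q$$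 and $$\begin{aligned} c_1&=\frac1{4\delta^3Y^3}\Big(-2Y^3\big(\alpha w+\tfrac{3g_3}8\beta\big)y+Y^2(8w^3+g_3)wp+2w^2(4w^3-g_3)^2q\Big),\\ c_2&=6z-12\beta\big(\alpha w+\tfrac{3g_3\beta}{16}\big)y^2+\frac{12w^2(16w^3+5g_3)}{Y^2}p^2+12\frac{(4w^3-g_3)^4w}{Y^6}q^2\\ &\quad+\frac{6w(\beta(8w^3+g_3)-8\alpha w)}{Y}yp-\frac{4(4w^3-g_3)^2(2\alpha-3\beta w^2)}{Y^3}yq+16\frac{(5w^3+g_3)(4w^3-g_3)^2}{Y^4}pq,\\ c_3&=\frac1{\delta Y^3}\Big(\tfrac12\alpha Y^3y-(2w^3+g_3)Y^2p-w(4w^3-g_3)^2q\Big), \end{aligned}$$ pairwise bracket-generate the Lie algebra of split $\mathfrak g_2$.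
   Context: A $(2,3,5)$-distribution is a rank 2 distribution $D$ on a 5-manifold such that $[D,D]$ has rank 3 and $[D,[D,D]]$ is the full tangent bundle. It is maximally symmetric if its associated Nurowski conformal structure of signature $(2,3)$ has vanishing Weyl tensor; its local symmetry algebra is then split $\mathfrak g_2$. Everything is local, on domains where denominators ($Y$, $4w^3-g_3$) do not vanish. Definition (pairwise bracket-generating split $\mathfrak g_2$). Given vector fields $S^1,S^2,S^3$, put $S^4=[S^1,S^2]$, $S^5=[S^2,S^3]$, $S^6=[S^3,S^1]$, $L^1=[S^1,S^4]$, $L^2=[S^2,S^4]$, $L^3=[S^2,S^5]$, $L^4=[S^3,S^5]$, $L^5=[S^3,S^6]$, $L^6=[S^1,S^6]$, $H=[S^2,S^6]$, $h=[S^4,S^3]$. One says $\{S^1,S^2,S^3\}$ pairwise bracket-generates the Lie algebra of split $\mathfrak g_2$ if the 14 vector fields $S^1,\dots,S^6$, $h^1=\frac14(h-H)$, $h^2=\frac{\sqrt3}{12}(h+H)$, $L^1,\dots,L^6$ form a basis of a 14-dimensional Lie algebra isomorphic to split $\mathfrak g_2$, with Cartan subalgebra spanned by $h^1,h^2$ and root vectors with the following roots (simultaneous eigenvalues of $(\mathrm{ad}\,h^1,\mathrm{ad}\,h^2)$): $S^1:(1,0)$, $S^5:(-1,0)$, $S^4:(\frac12,\frac{\sqrt3}2)$, $S^3:(-\frac12,-\frac{\sqrt3}2)$, $S^2:(-\frac12,\frac{\sqrt3}2)$, $S^6:(\frac12,-\frac{\sqrt3}2)$, $L^2:(0,\sqrt3)$,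 $L^5:(0,-\sqrt3)$, $L^1:(\frac32,\frac{\sqrt3}2)$, $L^4:(-\frac32,-\frac{\sqrt3}2)$, $L^3:(-\frac32,\frac{\sqrt3}2)$, $L^6:(\frac32,-\frac{\sqrt3}2)$. (For complex-valued data the algebra is taken over $\mathbb C$.) *)

theory Defs
  imports "HOL-Analysis.Analysis" "HOL-Library.Function_Algebras"
begin

locale lie_algebra = vector_space scale
  for scale :: "'a::field \<Rightarrow> 'v::ab_group_add \<Rightarrow> 'v" +
  fixes L :: "'v set" and br :: "'v \<Rightarrow> 'v \<Rightarrow> 'v"
  assumes subspace_L: "subspace L"
    and br_closed: "\<lbrakk>x \<in> L; y \<in> L\<rbrakk> \<Longrightarrow> br x y \<in> L"
    and br_add_left: "\<lbrakk>x \<in> L; y \<in> L; z \<in> L\<rbrakk> \<Longrightarrow> br (x + y) z = br x z + br y z"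
    and br_add_right: "\<lbrakk>x \<in> L; y \<in> L; z \<in> L\<rbrakk> \<Longrightarrow> br x (y + z) = br x y + br x z"
    and br_scale_left: "\<lbrakk>x \<in> L; y \<in> L\<rbrakk> \<Longrightarrow> br (scale c x) y = scale c (br x y)"
    and br_scale_right: "\<lbrakk>x \<in> L; y \<in> L\<rbrakk> \<Longrightarrow> br x (scale c y) = scale c (br x y)"
    and br_self: "x \<in> L \<Longrightarrow> br x x = 0"
    and jacobi: "\<lbrakk>x \<in> L; y \<in> L; z \<in> L\<rbrakk> \<Longrightarrow> br x (br y z) + br y (br z x) + br z (br x y) = 0"
begin

primrec lower_central_series :: "'v set \<Rightarrow> nat \<Rightarrow> 'v set" where
  "lower_central_series K 0 = K"
| "lower_central_series K (Suc n) = span {br x y | x y. x \<in> K \<and> y \<in> lower_central_series K n}"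

definition cartan_subalgebra :: "'v set \<Rightarrow> bool" where
  "cartan_subalgebra K \<longleftrightarrow>
     subspace K \<and> K \<subseteq> L \<and> (\<forall>x\<in>K. \<forall>y\<in>K. br x y \<in> K) \<and>
     (\<exists>n. lower_central_series K n = {0}) \<and>
     {x \<in> L. \<forall>y\<in>K. br x y \<in> K} = K"

end

definition lie_isomorphic ::
  "('a::field \<Rightarrow> 'v::ab_group_add \<Rightarrow> 'v) \<Rightarrow> 'v set \<Rightarrow> ('v \<Rightarrow> 'v \<Rightarrow> 'v) \<Rightarrow>
   ('a \<Rightarrow> 'u::ab_group_add \<Rightarrow> 'u) \<Rightarrow> 'u set \<Rightarrow> ('u \<Rightarrow> 'u \<Rightarrow> 'u) \<Rightarrow> bool" where
  "lie_isomorphic s L br s' L' br' \<longleftrightarrow>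
     (\<exists>\<phi>. bij_betw \<phi> L L' \<and>
        (\<forall>x\<in>L. \<forall>y\<in>L. \<phi> (x + y) = \<phi> x + \<phi> y) \<and>
        (\<forall>c. \<forall>x\<in>L. \<phi> (s c x) = s' c (\<phi> x)) \<and>
        (\<forall>x\<in>L. \<forall>y\<in>L. \<phi> (br x y) = br' (\<phi> x) (\<phi> y)))"

text \<open>
  Split \<open>\<gg>\<^sub>2\<close> is taken to be the derivation algebra of the split octonions. The latter are
  modelled by Zorn's vector matrices: \<open>(a, u, v, b)\<close> is the matrix with first row \<open>a, u\<close> and
  second row \<open>v, b\<close>. Over the complex numbers this is the complex simple Lie algebra of
  type \<open>G\<^sub>2\<close>.
\<close>

type_synonym 'a zorn = "'a \<times> ('a^3) \<times> ('a^3) \<times> 'a"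

definition dot3 :: "'a::field^3 \<Rightarrow> 'a^3 \<Rightarrow> 'a" where
  "dot3 u v = (\<Sum>i\<in>UNIV. u $ i * v $ i)"

definition cross_prod :: "'a::field^3 \<Rightarrow> 'a^3 \<Rightarrow> 'a^3" where
  "cross_prod u v = vector [u$2 * v$3 - u$3 * v$2, u$3 * v$1 - u$1 * v$3, u$1 * v$2 - u$2 * v$1]"

fun zorn_mult :: "'a::field zorn \<Rightarrow> 'a zorn \<Rightarrow> 'a zorn" where
  "zorn_mult (a, u, v, b) (a', u', v', b') =
     (a * a' + dot3 u v',
      a *s u' + b' *s u - cross_prod v v',
      a' *s v + b *s v' + cross_prod u u',
      b * b' + dot3 v u')"

fun zorn_scale :: "'a::field \<Rightarrow> 'a zorn \<Rightarrow> 'a zorn" where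
  "zorn_scale c (a, u, v, b) = (c * a, c *s u, c *s v, c * b)"

definition split_g2 :: "('a::field zorn \<Rightarrow> 'a zorn) set" where
  "split_g2 = {D. (\<forall>x y. D (x + y) = D x + D y) \<and>
                  (\<forall>c x. D (zorn_scale c x) = zorn_scale c (D x)) \<and>
                  (\<forall>x y. D (zorn_mult x y) = zorn_mult (D x) y + zorn_mult x (D y))}"

definition end_scale :: "'a::field \<Rightarrow> ('a zorn \<Rightarrow> 'a zorn) \<Rightarrow> 'a zorn \<Rightarrow> 'a zorn" where
  "end_scale c D = (\<lambda>x. zorn_scale c (D x))"

definition commutator :: "('a::field zorn \<Rightarrow> 'a zorn) \<Rightarrow> ('a zorn \<Rightarrow> 'a zorn) \<Rightarrow> 'a zorn \<Rightarrow> 'a zorn" where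
  "commutator D E = (\<lambda>x. D (E x) - E (D x))"

text \<open>
  The ground field \<open>'a :: real_normed_field\<close> covers the real and the complex case at once.
  A vector field on an open set \<open>U\<close> is represented by its coefficient function, continued
  by \<open>0\<close> outside \<open>U\<close>, so that equality of functions is equality of vector fields on \<open>U\<close>.
  On holomorphic coefficient functions, the Frechet derivative is complex linear, so that
  the bracket below is also the bracket of holomorphic vector fields.
\<close>

type_synonym 'a vfield = "'a^5 \<Rightarrow> 'a^5"

definition restrict_to :: "('a::zero^5) set \<Rightarrow> 'a vfield \<Rightarrow> 'a vfield" where
  "restrict_to U X = (\<lambda>x. if x \<in> U then X x else 0)"

definition vf_scale :: "'a::field \<Rightarrow> 'a vfield \<Rightarrow> 'a vfield" where
  "vf_scale c X = (\<lambda>x. c *s X x)"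

definition lie_bracket :: "('a::real_normed_field^5) set \<Rightarrow> 'a vfield \<Rightarrow> 'a vfield \<Rightarrow> 'a vfield" where
  "lie_bracket U X Y = restrict_to U
     (\<lambda>x. frechet_derivative Y (at x) (X x) - frechet_derivative X (at x) (Y x))"

definition pairwise_bracket_generates_split_g2 ::
  "('a::real_normed_field^5) set \<Rightarrow> 'a vfield \<Rightarrow> 'a vfield \<Rightarrow> 'a vfield \<Rightarrow> bool" where
  "pairwise_bracket_generates_split_g2 U S1 S2 S3 \<longleftrightarrow>
    (let br = lie_bracket U;
         r3 = of_real (sqrt 3) :: 'a;
         S4 = br S1 S2; S5 = br S2 S3; S6 = br S3 S1;
         L1 = br S1 S4; L2 = br S2 S4; L3 = br S2 S5;
         L4 = br S3 S5; L5 = br S3 S6; L6 = br S1 S6;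
         H = br S2 S6; h = br S4 S3;
         h1 = vf_scale (1/4) (h - H);
         h2 = vf_scale (r3/12) (h + H);
         basis = [S1, S2, S3, S4, S5, S6, h1, h2, L1, L2, L3, L4, L5, L6];
         \<gg> = module.span vf_scale (set basis);
         root = (\<lambda>X a b. br h1 X = vf_scale a X \<and> br h2 X = vf_scale b X)
     in distinct basis \<and> \<not> module.dependent vf_scale (set basis) \<and>
        lie_algebra vf_scale \<gg> br \<and>
        lie_isomorphic vf_scale \<gg> br end_scale split_g2 commutator \<and>
        lie_algebra.cartan_subalgebra vf_scale \<gg> br (module.span vf_scale {h1, h2}) \<and>
        root S1 1 0 \<and> root S5 (-1) 0 \<and>
        root S4 (1/2) (r3/2) \<and> root S3 (-1/2) (-r3/2) \<and>
        root S2 (-1/2) (r3/2) \<and> root S6 (1/2) (-r3/2) \<and>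
        root L2 0 r3 \<and> root L5 0 (-r3) \<and>
        root L1 (3/2) (r3/2) \<and> root L4 (-3/2) (-r3/2) \<and>
        root L3 (-3/2) (r3/2) \<and> root L6 (3/2) (-r3/2))"

text \<open>
  All iterated directional derivatives exist and are Frechet differentiable; the condition of
  linearity over \<open>'a\<close> is automatic in the real case and means holomorphy in the complex case.
\<close>

coinductive smooth_vfield :: "('a::real_normed_field^5) set \<Rightarrow> 'a vfield \<Rightarrow> bool" for U where
  "\<lbrakk>\<And>x. x \<in> U \<Longrightarrow> X differentiable (at x);
    \<And>x c v. x \<in> U \<Longrightarrow> frechet_derivative X (at x) (c *s v) = c *s frechet_derivative X (at x) v;
    \<And>v. smooth_vfield U (\<lambda>x. frechet_derivative X (at x) v)\<rbrakk>
   \<Longrightarrow> smooth_vfield U X"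

text \<open>
  A distribution is given by the subspaces \<open>D x\<close> of the tangent spaces at the points \<open>x\<close>.
  As sections may be multiplied by functions, \<open>[D, E]\<close> contains \<open>D\<close> and \<open>E\<close> for the
  distributions considered here, so these need not be added in \<open>bracket_dist\<close>.
\<close>

definition sections :: "('a::real_normed_field^5) set \<Rightarrow> ('a^5 \<Rightarrow> ('a^5) set) \<Rightarrow> 'a vfield set" where
  "sections U D = {X. smooth_vfield U X \<and> (\<forall>x\<in>U. X x \<in> D x)}"

definition bracket_dist :: "('a::real_normed_field^5) set \<Rightarrow> ('a^5 \<Rightarrow> ('a^5) set) \<Rightarrow>
    ('a^5 \<Rightarrow> ('a^5) set) \<Rightarrow> 'a^5 \<Rightarrow> ('a^5) set" where
  "bracket_dist U D E x =
     vec.span {lie_bracket U X Y x | X Y. X \<in> sections U D \<and> Y \<in> sections U E}"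

definition distribution_235 :: "('a::real_normed_field^5) set \<Rightarrow> ('a^5 \<Rightarrow> ('a^5) set) \<Rightarrow> bool" where
  "distribution_235 U D \<longleftrightarrow>
     (\<forall>x\<in>U. vec.subspace (D x) \<and> vec.dim (D x) = 2 \<and>
            vec.dim (bracket_dist U D D x) = 3 \<and>
            bracket_dist U D (bracket_dist U D D) x = UNIV)"

text \<open>
  The coordinates \<open>(w, y, z, p, q)\<close> of \<open>x :: 'a^5\<close> are \<open>x$1, \<dots>, x$5\<close>. All formulas are meant
  at points where \<open>Y\<close> and \<open>G = 4w\<^sup>3 - g\<^sub>3\<close> do not vanish.
\<close>

abbreviation d_w :: "'a::field^5" where "d_w \<equiv> axis 1 1"
abbreviation d_y :: "'a::field^5" where "d_y \<equiv> axis 2 1"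
abbreviation d_z :: "'a::field^5" where "d_z \<equiv> axis 3 1"
abbreviation d_p :: "'a::field^5" where "d_p \<equiv> axis 4 1"
abbreviation d_q :: "'a::field^5" where "d_q \<equiv> axis 5 1"

definition Yf :: "'a::field \<Rightarrow> 'a \<Rightarrow> 'a \<Rightarrow> 'a^5 \<Rightarrow> 'a" where
  "Yf \<alpha> \<beta> g3 x = (let w = x$1 in \<alpha> * w + \<beta> * (w^3 + g3/2))"

definition Gf :: "'a::field \<Rightarrow> 'a^5 \<Rightarrow> 'a" where
  "Gf g3 x = (let w = x$1 in 4 * w^3 - g3)"

definition X1 :: "'a::field vfield" where
  "X1 x = d_q"

definition X2 :: "'a::field \<Rightarrow> 'a \<Rightarrow> 'a \<Rightarrow> 'a vfield" where
  "X2 \<alpha> \<beta> g3 x =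
    (let p = x$4; q = x$5; Y = Yf \<alpha> \<beta> g3 x; G = Gf g3 x in
       (Y^2 / (2 * G)) *s d_w + p *s d_y + q *s d_p + (G^3 / Y^4 * q^2) *s d_z)"

definition DX :: "'a::field \<Rightarrow> 'a \<Rightarrow> 'a \<Rightarrow> 'a^5 \<Rightarrow> ('a^5) set" where
  "DX \<alpha> \<beta> g3 x = vec.span {X1 x, X2 \<alpha> \<beta> g3 x}"

text \<open>1-forms as functions of the point \<open>x\<close> and the tangent vector \<open>v\<close>; \<open>dw v = v$1\<close> etc.\<close>

definition \<omega>1 :: "'a::field \<Rightarrow> 'a \<Rightarrow> 'a \<Rightarrow> 'a^5 \<Rightarrow> 'a^5 \<Rightarrow> 'a" where
  "\<omega>1 \<alpha> \<beta> g3 x v =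
    (let p = x$4; Y = Yf \<alpha> \<beta> g3 x; G = Gf g3 x; dw = v$1; dy = v$2 in
       dy - 2 * p / Y^2 * G * dw)"

definition \<omega>2 :: "'a::field \<Rightarrow> 'a \<Rightarrow> 'a \<Rightarrow> 'a^5 \<Rightarrow> 'a^5 \<Rightarrow> 'a" where
  "\<omega>2 \<alpha> \<beta> g3 x v =
    (let q = x$5; Y = Yf \<alpha> \<beta> g3 x; G = Gf g3 x; dw = v$1; dp = v$4 in
       dp - 2 * q / Y^2 * G * dw)"

definition \<omega>3 :: "'a::field \<Rightarrow> 'a \<Rightarrow> 'a \<Rightarrow> 'a^5 \<Rightarrow> 'a^5 \<Rightarrow> 'a" where
  "\<omega>3 \<alpha> \<beta> g3 x v =
    (let q = x$5; Y = Yf \<alpha> \<beta> g3 x; G = Gf g3 x; dw = v$1; dz = v$3 in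
       dz - 2 * q^2 / Y^6 * G^4 * dw)"

definition S1 :: "'a::field \<Rightarrow> 'a \<Rightarrow> 'a \<Rightarrow> 'a \<Rightarrow> 'a vfield" where
  "S1 \<alpha> \<beta> g3 \<delta> x =
    (let w = x$1; y = x$2; p = x$4; q = x$5; Y = Yf \<alpha> \<beta> g3 x; G = Gf g3 x in
       (6 * \<beta> * \<delta>^2 * Y^3 / G^2 * y
        + 24 * \<delta>^2 * w * Y^2 / G^2 * p
        + 12 * \<delta>^2 * (\<alpha> * (8 * w^3 + g3) + 9 * \<beta> * g3 * w^2) / (G * Y) * q) *s X1 x
       - (8 * \<delta>^2 * G / Y^2) *s X2 \<alpha> \<beta> g3 x)"

definition S2 :: "'a::field \<Rightarrow> 'a \<Rightarrow> 'a \<Rightarrow> 'a \<Rightarrow> 'a vfield" where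
  "S2 \<alpha> \<beta> g3 \<delta> x =
    (let Y = Yf \<alpha> \<beta> g3 x; G = Gf g3 x in (Y^3 / (4 * \<delta> * G^2)) *s X1 x)"

definition Z1 :: "'a::field \<Rightarrow> 'a \<Rightarrow> 'a \<Rightarrow> 'a \<Rightarrow> 'a vfield" where
  "Z1 \<alpha> \<beta> g3 \<delta> x =
    (let w = x$1; q = x$5; Y = Yf \<alpha> \<beta> g3 x; G = Gf g3 x in
       (- (2 * \<delta> * w / Y)) *s d_y
       + (4 * \<delta> * G^2 / Y^3 * q) *s d_z
       + (\<delta> * (\<beta> * (8 * w^3 + g3) + 4 * \<alpha> * w) / (2 * G)) *s d_p
       - (12 * \<delta> * Y^3 * w^2 / G^3) *s d_q)"

definition c1 :: "'a::field \<Rightarrow> 'a \<Rightarrow> 'a \<Rightarrow> 'a \<Rightarrow> 'a^5 \<Rightarrow> 'a" where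
  "c1 \<alpha> \<beta> g3 \<delta> x =
    (let w = x$1; y = x$2; p = x$4; q = x$5; Y = Yf \<alpha> \<beta> g3 x; G = Gf g3 x in
       1 / (4 * \<delta>^3 * Y^3) *
         (- 2 * Y^3 * (\<alpha> * w + 3 * g3 / 8 * \<beta>) * y
          + Y^2 * (8 * w^3 + g3) * w * p
          + 2 * w^2 * G^2 * q))"

definition c2 :: "'a::field \<Rightarrow> 'a \<Rightarrow> 'a \<Rightarrow> 'a^5 \<Rightarrow> 'a" where
  "c2 \<alpha> \<beta> g3 x =
    (let w = x$1; y = x$2; z = x$3; p = x$4; q = x$5; Y = Yf \<alpha> \<beta> g3 x; G = Gf g3 x in
       6 * z
       - 12 * \<beta> * (\<alpha> * w + 3 * g3 * \<beta> / 16) * y^2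
       + 12 * w^2 * (16 * w^3 + 5 * g3) / Y^2 * p^2
       + 12 * (G^4 * w / Y^6) * q^2
       + 6 * w * (\<beta> * (8 * w^3 + g3) - 8 * \<alpha> * w) / Y * y * p
       - 4 * G^2 * (2 * \<alpha> - 3 * \<beta> * w^2) / Y^3 * y * q
       + 16 * ((5 * w^3 + g3) * G^2 / Y^4) * p * q)"

definition c3 :: "'a::field \<Rightarrow> 'a \<Rightarrow> 'a \<Rightarrow> 'a \<Rightarrow> 'a^5 \<Rightarrow> 'a" where
  "c3 \<alpha> \<beta> g3 \<delta> x =
    (let w = x$1; y = x$2; p = x$4; q = x$5; Y = Yf \<alpha> \<beta> g3 x; G = Gf g3 x in
       1 / (\<delta> * Y^3) *
         (1/2 * \<alpha> * Y^3 * y - (2 * w^3 + g3) * Y^2 * p - w * G^2 * q))"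

definition S3 :: "'a::field \<Rightarrow> 'a \<Rightarrow> 'a \<Rightarrow> 'a \<Rightarrow> 'a vfield" where
  "S3 \<alpha> \<beta> g3 \<delta> x =
     - c1 \<alpha> \<beta> g3 \<delta> x *s S1 \<alpha> \<beta> g3 \<delta> x
     + c2 \<alpha> \<beta> g3 x *s S2 \<alpha> \<beta> g3 \<delta> x
     - (c3 \<alpha> \<beta> g3 \<delta> x)^2 *s Z1 \<alpha> \<beta> g3 \<delta> x"

end

(*
  Split g2 acts on the projectivized quadric of null imaginary split octonions. Suitable functions
  (w, r, n, e, Q) of the given coordinates define an immersion psi into this quadric, under which
  S1, S2, S3 become, up to constants, the fields induced by the derivations D with D(1,0,0,0) =
  (0,s,0,0) for s = e_2, e_3, e_1. These three derivations generate split g2. A vector field on U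
  is determined by its image under the derivative of psi, so brackets of vector fields correspond
  to commutators of derivations, and every assertion about the generated Lie algebra reduces to a
  computation with derivations, once the kernel of this correspondence, an ideal of split g2, is
  seen to be trivial.
*)

theory Submission
  imports Defs
begin

section \<open>Rational functions and their derivatives\<close>

text \<open>Computing iterated brackets from the rational coefficients of the fields would be
  unmanageable. The immersion confines the concrete calculus to first derivatives of
  \<open>psi\<close> along three given fields. All iterated brackets are then formed in the
  decomposition of split g2 into sl_3, V and V^*, written as a triple \<open>(A, s, t)\<close>. The
  three generators are weight vectors of V, their pairwise brackets lie in V^*, the six fields
  \<open>L1\<close>, ..., \<open>L6\<close> are off-diagonal elementary matrices, and
  \<open>H\<close> and \<open>h\<close> are diagonal. Rescaling the generators by \<open>a\<close>,
  \<open>b\<close>, \<open>c\<close> multiplies \<open>H\<close> and \<open>h\<close> by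
  \<open>a * b * c\<close>. The prescribed eigenvalues force \<open>a * b * c = - 1\<close>, which
  the scalars \<open>4 * \<delta>^2\<close>, \<open>- 1 / (2 * \<delta>)\<close>,
  \<open>1 / (2 * \<delta>)\<close> satisfy. Brackets can correspond to commutators only if second
  derivatives commute and derivatives are linear over \<open>'a\<close>. Both are available for
  \<open>regular\<close> functions, the only ones met on this side. Sections of the
  (2,3,5)-distribution are arbitrary smooth fields, so that part works with first derivatives of
  components.\<close>

text \<open>
  An inductively generated class of functions replaces smoothness: it is closed under directional
  derivatives, and the symmetry of second derivatives is proved by rule induction.
\<close>

inductive regular :: "('a::real_normed_field^'n) set \<Rightarrow> ('a^'n \<Rightarrow> 'a) \<Rightarrow> bool" for U where
  const: "regular U (\<lambda>x. c)"
| coord: "regular U (\<lambda>x. x $ i)"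
| add: "\<lbrakk>regular U f; regular U g\<rbrakk> \<Longrightarrow> regular U (\<lambda>x. f x + g x)"
| mult: "\<lbrakk>regular U f; regular U g\<rbrakk> \<Longrightarrow> regular U (\<lambda>x. f x * g x)"
| inverse: "\<lbrakk>regular U f; \<And>x. x \<in> U \<Longrightarrow> f x \<noteq> 0\<rbrakk> \<Longrightarrow> regular U (\<lambda>x. inverse (f x))"
| cong: "\<lbrakk>regular U f; \<And>x. x \<in> U \<Longrightarrow> g x = f x\<rbrakk> \<Longrightarrow> regular U g"

lemma regular_minus: "regular U f \<Longrightarrow> regular U (\<lambda>x. - f x)"
  by (rule regular.cong[OF regular.mult[OF regular.const[of U "-1"]]]) auto

lemma regular_diff: "regular U f \<Longrightarrow> regular U g \<Longrightarrow> regular U (\<lambda>x. f x - g x)"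
  using regular.add[OF _ regular_minus, of U f g] by simp

lemma regular_divide:
  "regular U f \<Longrightarrow> regular U g \<Longrightarrow> (\<And>x. x \<in> U \<Longrightarrow> g x \<noteq> 0) \<Longrightarrow> regular U (\<lambda>x. f x / g x)"
  unfolding divide_inverse by (intro regular.mult regular.inverse)

lemma regular_power: "regular U f \<Longrightarrow> regular U (\<lambda>x. f x ^ n)"
  by (induction n) (auto intro: regular.const regular.add regular.mult)

lemma regular_sum: "(\<And>i. i \<in> I \<Longrightarrow> regular U (f i)) \<Longrightarrow> regular U (\<lambda>x. \<Sum>i\<in>I. f i x)"
  by (induction I rule: infinite_finite_induct) (auto intro: regular.const regular.add regular.mult)

lemmas regular_intros = regular.const regular.coord regular.add regular.mult
  regular_minus regular_diff regular_divide regular_power regular_sum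

lemma frechet_derivative_cong_open:
  assumes "open U" "x \<in> U" "\<And>y. y \<in> U \<Longrightarrow> f y = g y"
  shows "frechet_derivative f (at x) = frechet_derivative g (at x)"
proof -
  have "(f has_derivative D) (at x) \<longleftrightarrow> (g has_derivative D) (at x)" for D
    using has_derivative_transform_within_open[of f D x UNIV U g]
      has_derivative_transform_within_open[of g D x UNIV U f] assms by auto
  then show ?thesis unfolding frechet_derivative_def by simp
qed

lemma differentiable_cong_open:
  assumes "open U" "x \<in> U" "\<And>y. y \<in> U \<Longrightarrow> g y = f y" "f differentiable (at x)"
  shows "g differentiable (at x)"
  using assms has_derivative_transform_within_open[of f _ x UNIV U g]
  unfolding differentiable_def by fastforce

lemma frechet_derivative_eqI: "(f has_derivative D) (at x) \<Longrightarrow> frechet_derivative f (at x) = D"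
  using frechet_derivative_at by metis

lemma frechet_derivative_coord [simp]: "frechet_derivative (\<lambda>x. x $ i) (at x) v = v $ i"
  by (simp add: frechet_derivative_eqI[OF bounded_linear_imp_has_derivative[OF bounded_linear_vec_nth]])

lemma frechet_derivative_add:
  assumes "f differentiable (at x)" "g differentiable (at x)"
  shows "frechet_derivative (\<lambda>x. f x + g x) (at x) v
    = frechet_derivative f (at x) v + frechet_derivative g (at x) v"
  using frechet_derivative_eqI[OF has_derivative_add[OF assms[unfolded frechet_derivative_works]]]
  by simp

lemma frechet_derivative_uminus:
  assumes "f differentiable (at x)"
  shows "frechet_derivative (\<lambda>x. - f x) (at x) v = - frechet_derivative f (at x) v"
  using frechet_derivative_eqI[OF has_derivative_minus[OF assms[unfolded frechet_derivative_works]]]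
  by simp

lemma frechet_derivative_diff:
  assumes "f differentiable (at x)" "g differentiable (at x)"
  shows "frechet_derivative (\<lambda>x. f x - g x) (at x) v
    = frechet_derivative f (at x) v - frechet_derivative g (at x) v"
  using frechet_derivative_eqI[OF has_derivative_diff[OF assms[unfolded frechet_derivative_works]]]
  by simp

lemma frechet_derivative_mult:
  fixes f g :: "'b::real_normed_vector \<Rightarrow> 'a::real_normed_field"
  assumes "f differentiable (at x)" "g differentiable (at x)"
  shows "frechet_derivative (\<lambda>x. f x * g x) (at x) v
    = f x * frechet_derivative g (at x) v + frechet_derivative f (at x) v * g x"
  using frechet_derivative_eqI[OF has_derivative_mult[OF assms[unfolded frechet_derivative_works]]]
  by simp

lemma frechet_derivative_inverse:
  fixes f :: "'b::real_normed_vector \<Rightarrow> 'a::real_normed_field"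
  assumes "f differentiable (at x)" "f x \<noteq> 0"
  shows "frechet_derivative (\<lambda>x. inverse (f x)) (at x) v
    = - (inverse (f x) * inverse (f x) * frechet_derivative f (at x) v)"
  using frechet_derivative_eqI[OF Deriv.has_derivative_inverse[where f = f and x = x, OF assms(2) assms(1)[unfolded frechet_derivative_works]]]
  by (simp add: mult_ac)

lemma frechet_derivative_divide:
  fixes f g :: "'b::real_normed_vector \<Rightarrow> 'a::real_normed_field"
  assumes "f differentiable (at x)" "g differentiable (at x)" "g x \<noteq> 0"
  shows "frechet_derivative (\<lambda>x. f x / g x) (at x) v
    = (frechet_derivative f (at x) v * g x - f x * frechet_derivative g (at x) v) / (g x * g x)"
  using frechet_derivative_eqI[OF has_derivative_divide'[OF assms(1,2)[unfolded frechet_derivative_works] assms(3)]]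
  by simp

lemma frechet_derivative_power:
  fixes f :: "'b::real_normed_vector \<Rightarrow> 'a::real_normed_field"
  assumes "f differentiable (at x)"
  shows "frechet_derivative (\<lambda>x. f x ^ n) (at x) v
    = of_nat n * f x ^ (n - 1) * frechet_derivative f (at x) v"
  using frechet_derivative_eqI[OF has_derivative_power[OF assms[unfolded frechet_derivative_works]]]
  by (simp add: mult_ac)

lemma frechet_derivative_bounded_linear:
  assumes "bounded_linear T" "f differentiable (at x)"
  shows "frechet_derivative (\<lambda>x. T (f x)) (at x) v = T (frechet_derivative f (at x) v)"
  using frechet_derivative_eqI[OF bounded_linear.has_derivative[OF assms(1) assms(2)[unfolded frechet_derivative_works]]]
  by simp

lemmas frechet_derivative_simps = frechet_derivative_add frechet_derivative_uminus
  frechet_derivative_diff frechet_derivative_mult frechet_derivative_inverse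
  frechet_derivative_divide frechet_derivative_power

lemma differentiable_inverse_field:
  fixes f :: "'b::real_normed_vector \<Rightarrow> 'a::real_normed_field"
  assumes "f differentiable (at x)" "f x \<noteq> 0"
  shows "(\<lambda>x. inverse (f x)) differentiable (at x)"
  using Deriv.has_derivative_inverse[where f = f and x = x, OF assms(2)] assms(1) unfolding differentiable_def by blast

lemma differentiable_coord: "(\<lambda>x. x $ i) differentiable (at (x :: 'a::real_normed_vector^'n))"
  using bounded_linear_imp_has_derivative[OF bounded_linear_vec_nth] unfolding differentiable_def by blast

lemma regular_differentiable:
  assumes "open U" "regular U f" "x \<in> U"
  shows "f differentiable (at x)"
  using assms(2)
proof induction
  case (cong f g)
  then show ?case using differentiable_cong_open[OF assms(1,3)] by blast
qed (auto intro: differentiable_inverse_field assms(3) simp: differentiable_coord)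

lemma regular_derivative:
  assumes "open U" "regular U f"
  shows "regular U (\<lambda>x. frechet_derivative f (at x) v)"
  using assms(2)
proof induction
  case (add f g)
  show ?case
    by (rule regular.cong[OF regular.add[OF add.IH]])
      (simp add: frechet_derivative_add regular_differentiable[OF assms(1)] add.hyps)
next
  case (mult f g)
  show ?case
    by (rule regular.cong[OF regular.add[OF regular.mult[OF mult.hyps(1) mult.IH(2)] regular.mult[OF mult.IH(1) mult.hyps(2)]]])
      (simp add: frechet_derivative_mult regular_differentiable[OF assms(1)] mult.hyps)
next
  case (inverse f)
  show ?case
    by (rule regular.cong[OF regular_minus[OF regular.mult[OF regular.mult[OF regular.inverse[OF inverse.hyps] regular.inverse[OF inverse.hyps]] inverse.IH]]])
      (simp_all add: frechet_derivative_inverse regular_differentiable[OF assms(1)] inverse.hyps)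
next
  case (cong f g)
  then show ?case
    by (simp add: regular.cong[OF cong.IH] frechet_derivative_cong_open[OF assms(1) _ cong.hyps(2)])
qed (auto intro: regular.const regular.add regular.mult)

text \<open>A Frechet derivative is a priori only real linear. Linearity over \<open>'a\<close>
  holds for the coordinates and passes through every formation rule; over the complex numbers this
  is holomorphy.\<close>

lemma regular_derivative_scale:
  assumes "open U" "regular U f" "x \<in> U"
  shows "frechet_derivative f (at x) (c *s v) = c * frechet_derivative f (at x) v"
  using assms(2)
proof induction
  case (cong f g)
  then show ?case using frechet_derivative_cong_open[OF assms(1,3), of g f] by simp
qed (simp_all add: frechet_derivative_simps regular_differentiable[OF assms(1)] assms(3) algebra_simps)

text \<open>For each formation rule the iterated derivative is written out in a form that is visibly
  symmetric in \<open>v\<close> and \<open>w\<close> as soon as those of the constituents are.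
  Openness of \<open>U\<close> allows the inner derivative to be replaced by its formula before
  differentiating again.\<close>

lemma regular_derivative_symmetric:
  assumes "open U" "regular U f" "x \<in> U"
  shows "frechet_derivative (\<lambda>x. frechet_derivative f (at x) v) (at x) w
    = frechet_derivative (\<lambda>x. frechet_derivative f (at x) w) (at x) v"
  using assms(2)
proof induction
  case (add f g)
  have "frechet_derivative (\<lambda>x. frechet_derivative (\<lambda>x. f x + g x) (at x) v) (at x) w
    = frechet_derivative (\<lambda>x. frechet_derivative f (at x) v) (at x) w
    + frechet_derivative (\<lambda>x. frechet_derivative g (at x) v) (at x) w" for v w
    apply (subst frechet_derivative_cong_open[OF assms(1,3),
        where g = "\<lambda>x. frechet_derivative f (at x) v + frechet_derivative g (at x) v"])
    using assms add.hyps
    by (auto simp: frechet_derivative_simps regular_differentiable[OF assms(1)] regular_derivative)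
  then show ?case by (simp add: add.IH)
next
  case (mult f g)
  have "frechet_derivative (\<lambda>x. frechet_derivative (\<lambda>x. f x * g x) (at x) v) (at x) w
    = f x * frechet_derivative (\<lambda>x. frechet_derivative g (at x) v) (at x) w
    + frechet_derivative f (at x) w * frechet_derivative g (at x) v
    + frechet_derivative f (at x) v * frechet_derivative g (at x) w
    + frechet_derivative (\<lambda>x. frechet_derivative f (at x) v) (at x) w * g x" for v w
    apply (subst frechet_derivative_cong_open[OF assms(1,3),
        where g = "\<lambda>x. f x * frechet_derivative g (at x) v + frechet_derivative f (at x) v * g x"])
    using assms mult.hyps
    by (auto simp: frechet_derivative_simps regular_differentiable[OF assms(1)] regular_derivative)
  then show ?case by (simp add: mult.IH)
next
  case (inverse f)
  have "frechet_derivative (\<lambda>x. frechet_derivative (\<lambda>x. inverse (f x)) (at x) v) (at x) w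
    = 2 * inverse (f x) ^ 3 * frechet_derivative f (at x) v * frechet_derivative f (at x) w
    - inverse (f x) ^ 2 * frechet_derivative (\<lambda>x. frechet_derivative f (at x) v) (at x) w" for v w
    apply (subst frechet_derivative_cong_open[OF assms(1,3),
        where g = "\<lambda>x. - (inverse (f x) * inverse (f x) * frechet_derivative f (at x) v)"])
    using assms inverse.hyps
    by (auto simp: frechet_derivative_simps regular_differentiable[OF assms(1)] regular_derivative
        differentiable_inverse_field power2_eq_square power3_eq_cube algebra_simps)
  then show ?case by (simp add: inverse.IH)
next
  case (cong f g)
  have "frechet_derivative (\<lambda>x. frechet_derivative g (at x) v) (at x) w
    = frechet_derivative (\<lambda>x. frechet_derivative f (at x) v) (at x) w" for v w
    using cong.hyps by (subst frechet_derivative_cong_open[OF assms(1,3),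
          where g = "\<lambda>x. frechet_derivative f (at x) v"])
      (auto simp: frechet_derivative_cong_open[OF assms(1) _ cong.hyps(2)]
        regular_differentiable[OF assms(1)] regular_derivative assms)
  then show ?case by (simp add: cong.IH)
qed simp_all

section \<open>Brackets of vector fields with rational coefficients\<close>

text \<open>Entries come from an arbitrary normed space, so vector-valued derivatives are assembled
  from scalar ones through \<open>vec_sum_axis\<close>; this supplies the continuity of each
  summand.\<close>

lemma bounded_linear_axis: "bounded_linear (\<lambda>c::'a::real_normed_vector. axis i c :: 'a^'n)"
proof (rule bounded_linear_intro[where K = 1])
  fix c :: 'a
  have "(norm ((axis i c :: 'a^'n) $ j))\<^sup>2 = (if j = i then (norm c)\<^sup>2 else 0)" for j
    by (simp add: axis_def)
  then show "norm (axis i c :: 'a^'n) \<le> norm c * 1"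
    by (simp add: norm_vec_def L2_set_def)
qed (simp_all add: vec_eq_iff axis_def)

lemma vec_sum_axis: "(x :: 'a::comm_monoid_add^'n) = (\<Sum>i\<in>UNIV. axis i (x $ i))"
  by (simp add: vec_eq_iff axis_def)

lemma bounded_linear_vecI:
  fixes f :: "'b::real_normed_vector \<Rightarrow> 'a::real_normed_vector^'n"
  assumes "\<And>i. bounded_linear (\<lambda>x. f x $ i)"
  shows "bounded_linear f"
proof -
  have "bounded_linear (\<lambda>x. \<Sum>i\<in>UNIV. axis i (f x $ i) :: 'a^'n)"
    by (intro bounded_linear_sum bounded_linear_compose[OF bounded_linear_axis] assms)
  then show ?thesis by (simp flip: vec_sum_axis)
qed

lemma has_derivative_vecI:
  fixes f :: "'b::real_normed_vector \<Rightarrow> 'a::real_normed_vector^'n"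
  assumes "\<And>i. ((\<lambda>x. f x $ i) has_derivative (\<lambda>v. D v $ i)) F"
  shows "(f has_derivative D) F"
proof -
  have "((\<lambda>x. \<Sum>i\<in>UNIV. axis i (f x $ i) :: 'a^'n) has_derivative
      (\<lambda>v. \<Sum>i\<in>UNIV. axis i (D v $ i))) F"
    by (intro has_derivative_sum bounded_linear.has_derivative[OF bounded_linear_axis] assms)
  then show ?thesis by (simp flip: vec_sum_axis)
qed

lemma differentiable_vecI:
  fixes f :: "'b::real_normed_vector \<Rightarrow> 'a::real_normed_vector^'n"
  assumes "\<And>i. (\<lambda>x. f x $ i) differentiable F"
  shows "f differentiable F"
proof -
  obtain D where "((\<lambda>x. f x $ i) has_derivative D i) F" for i
    using assms unfolding differentiable_def by metis
  then have "(f has_derivative (\<lambda>v. \<chi> i. D i v)) F"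
    by (intro has_derivative_vecI) simp
  then show ?thesis unfolding differentiable_def by blast
qed

lemma frechet_derivative_nth:
  assumes "f differentiable (at x)"
  shows "frechet_derivative f (at x) v $ i = frechet_derivative (\<lambda>x. f x $ i) (at x) v"
  using frechet_derivative_bounded_linear[OF bounded_linear_vec_nth assms] by simp

definition regular_field :: "('a::real_normed_field^'n) set \<Rightarrow> ('a^'n \<Rightarrow> 'a^'n) \<Rightarrow> bool" where
  "regular_field U X \<longleftrightarrow> (\<forall>i. regular U (\<lambda>x. X x $ i))"

definition vf_apply :: "('a::real_normed_field^'n \<Rightarrow> 'a^'n) \<Rightarrow> ('a^'n \<Rightarrow> 'b::real_normed_vector) \<Rightarrow>
    'a^'n \<Rightarrow> 'b" where
  "vf_apply X f x = frechet_derivative f (at x) (X x)"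

lemma regular_field_differentiable:
  "open U \<Longrightarrow> regular_field U X \<Longrightarrow> x \<in> U \<Longrightarrow> X differentiable (at x)"
  unfolding regular_field_def by (blast intro: differentiable_vecI regular_differentiable)

lemma regular_derivative_expansion:
  assumes "open U" "regular U f" "x \<in> U"
  shows "frechet_derivative f (at x) v = (\<Sum>i\<in>UNIV. v $ i * frechet_derivative f (at x) (axis i 1))"
proof -
  have lin: "linear (frechet_derivative f (at x))"
    using regular_differentiable[OF assms] by (rule linear_frechet_derivative)
  have "frechet_derivative f (at x) (\<Sum>i\<in>UNIV. v $ i *s axis i 1)
      = (\<Sum>i\<in>UNIV. v $ i * frechet_derivative f (at x) (axis i 1))"
    by (simp add: linear_sum[OF lin] regular_derivative_scale[OF assms])
  then show ?thesis by (simp add: basis_expansion)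
qed

lemma regular_vf_apply:
  assumes "open U" "regular U f" "regular_field U X"
  shows "regular U (vf_apply X f)"
proof (rule regular.cong)
  show "regular U (\<lambda>x. \<Sum>i\<in>UNIV. X x $ i * frechet_derivative f (at x) (axis i 1))"
    using assms regular_derivative[OF assms(1,2)] unfolding regular_field_def
    by (intro regular_sum regular.mult) auto
qed (unfold vf_apply_def, rule regular_derivative_expansion[OF assms(1,2)])

lemma vf_apply_cong_open:
  assumes "open U" "x \<in> U" "\<And>y. y \<in> U \<Longrightarrow> f y = g y"
  shows "vf_apply X f x = vf_apply X g x"
  unfolding vf_apply_def using frechet_derivative_cong_open[OF assms] by simp

lemma lie_bracket_nth:
  assumes "open U" "regular_field U X" "regular_field U Y" "x \<in> U"
  shows "lie_bracket U X Y x $ i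
    = vf_apply X (\<lambda>x. Y x $ i) x - vf_apply Y (\<lambda>x. X x $ i) x"
  using assms
  by (simp add: lie_bracket_def restrict_to_def vf_apply_def frechet_derivative_nth
      regular_field_differentiable)

lemma regular_field_lie_bracket:
  assumes "open U" "regular_field U X" "regular_field U Y"
  shows "regular_field U (lie_bracket U X Y)"
  unfolding regular_field_def
proof
  fix i
  have "regular U (\<lambda>x. vf_apply X (\<lambda>x. Y x $ i) x - vf_apply Y (\<lambda>x. X x $ i) x)"
    using assms unfolding regular_field_def
    by (intro regular_diff regular_vf_apply) (auto simp: regular_field_def)
  then show "regular U (\<lambda>x. lie_bracket U X Y x $ i)"
    by (rule regular.cong) (simp add: lie_bracket_nth[OF assms])
qed

text \<open>Regularity is inherited by directional derivatives, hence is itself an invariant for the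
  coinduction.\<close>

lemma smooth_vfield_regular_field:
  assumes "open U" "regular_field U X"
  shows "smooth_vfield U X"
  using assms(2)
proof (coinduction arbitrary: X rule: smooth_vfield.coinduct)
  case smooth_vfield
  have "frechet_derivative X (at x) (c *s v) = c *s frechet_derivative X (at x) v" if "x \<in> U" for x c v
    using smooth_vfield that regular_derivative_scale[OF assms(1)]
    by (simp add: vec_eq_iff frechet_derivative_nth regular_field_differentiable[OF assms(1)] regular_field_def)
  moreover have "regular_field U (\<lambda>x. frechet_derivative X (at x) v)" for v
    unfolding regular_field_def
  proof
    fix i
    have "regular U (\<lambda>x. frechet_derivative (\<lambda>x. X x $ i) (at x) v)"
      using smooth_vfield by (intro regular_derivative assms(1)) (auto simp: regular_field_def)
    then show "regular U (\<lambda>x. frechet_derivative X (at x) v $ i)"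
      by (rule regular.cong)
        (simp add: frechet_derivative_nth regular_field_differentiable[OF assms(1) smooth_vfield])
  qed
  ultimately show ?case
    using regular_field_differentiable[OF assms(1) smooth_vfield] by (intro exI[of _ X]) simp
qed

text \<open>Separates the first-order part, where \<open>X\<close> differentiates the coefficients
  of \<open>Y\<close> and which is one half of the bracket, from the second-order part, which does
  not distinguish \<open>X\<close> from \<open>Y\<close>.\<close>

lemma vf_apply_vf_apply:
  assumes "open U" "regular_field U X" "regular_field U Y" "regular U f" "x \<in> U"
  shows "vf_apply X (vf_apply Y f) x
    = (\<Sum>i\<in>UNIV. vf_apply X (\<lambda>x. Y x $ i) x * frechet_derivative f (at x) (axis i 1))
    + (\<Sum>i\<in>UNIV. \<Sum>j\<in>UNIV. Y x $ i * X x $ j *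
        frechet_derivative (\<lambda>x. frechet_derivative f (at x) (axis i 1)) (at x) (axis j 1))"
proof -
  let ?d = "\<lambda>i x. frechet_derivative f (at x) (axis i 1)"
  have regY: "regular U (\<lambda>x. Y x $ i)" for i
    using assms(3) by (simp add: regular_field_def)
  have reg_d: "regular U (?d i)" for i
    by (rule regular_derivative[OF assms(1,4)])
  note diff = regular_differentiable[OF assms(1) _ assms(5)]
  have "vf_apply X (vf_apply Y f) x = vf_apply X (\<lambda>x. \<Sum>i\<in>UNIV. Y x $ i * ?d i x) x"
    by (rule vf_apply_cong_open[OF assms(1,5)])
      (simp add: vf_apply_def regular_derivative_expansion[OF assms(1,4)])
  also have "\<dots> = (\<Sum>i\<in>UNIV. vf_apply X (\<lambda>x. Y x $ i * ?d i x) x)"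
    unfolding vf_apply_def
    by (rule fun_cong[OF frechet_derivative_eqI[OF has_derivative_sum]])
      (rule iffD1[OF frechet_derivative_works], rule diff, rule regular.mult[OF regY reg_d])
  also have "\<dots> = (\<Sum>i\<in>UNIV. vf_apply X (\<lambda>x. Y x $ i) x * ?d i x + Y x $ i * vf_apply X (?d i) x)"
    unfolding vf_apply_def
    by (simp add: frechet_derivative_mult[OF diff[OF regY] diff[OF reg_d]] add.commute)
  also have "\<dots> = (\<Sum>i\<in>UNIV. vf_apply X (\<lambda>x. Y x $ i) x * ?d i x)
      + (\<Sum>i\<in>UNIV. Y x $ i * (\<Sum>j\<in>UNIV. X x $ j * frechet_derivative (?d i) (at x) (axis j 1)))"
    by (simp add: sum.distrib vf_apply_def regular_derivative_expansion[OF assms(1) reg_d assms(5), of _ "X x"])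
  finally show ?thesis by (simp add: sum_distrib_left mult.assoc)
qed

lemma vf_apply_lie_bracket:
  assumes "open U" "regular_field U X" "regular_field U Y" "regular U f" "x \<in> U"
  shows "vf_apply (lie_bracket U X Y) f x = vf_apply X (vf_apply Y f) x - vf_apply Y (vf_apply X f) x"
proof -
  let ?d = "\<lambda>i x. frechet_derivative f (at x) (axis i 1)"
  let ?dd = "\<lambda>i j. frechet_derivative (?d i) (at x) (axis j 1)"
  \<comment> \<open>The second-order parts of the two compositions agree: exchange the summation
    indices and use symmetry of second derivatives.\<close>
  have "(\<Sum>i\<in>UNIV. \<Sum>j\<in>UNIV. Y x $ i * X x $ j * ?dd i j)
      = (\<Sum>i\<in>UNIV. \<Sum>j\<in>UNIV. X x $ i * Y x $ j * ?dd i j)"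
    by (subst sum.swap, intro sum.cong refl, subst regular_derivative_symmetric[OF assms(1,4,5)]) simp
  then have "vf_apply X (vf_apply Y f) x - vf_apply Y (vf_apply X f) x
      = (\<Sum>i\<in>UNIV. lie_bracket U X Y x $ i * ?d i x)"
    by (simp add: vf_apply_vf_apply[OF assms(1)] assms lie_bracket_nth left_diff_distrib sum_subtractf)
  then show ?thesis
    unfolding vf_apply_def regular_derivative_expansion[OF assms(1,4,5), symmetric] by simp
qed

section \<open>Derivations of the split octonions\<close>

text \<open>For traceless \<open>A\<close> this is the general element of sl_3 + V + V^*. The pair
  \<open>(s, t)\<close> is the image of the idempotent \<open>(1, 0, 0, 0)\<close>; the derivations
  killing that idempotent act by \<open>A\<close> on \<open>u\<close> and by the dual action on
  \<open>v\<close>.\<close>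

fun der :: "'a::field^3^3 \<Rightarrow> 'a^3 \<Rightarrow> 'a^3 \<Rightarrow> 'a zorn \<Rightarrow> 'a zorn" where
  "der A s t (a, u, v, b) =
     (- dot3 t u - dot3 s v,
      (a - b) *s s + A *v u + cross_prod t v,
      (a - b) *s t + cross_prod s u - transpose A *v v,
      dot3 t u + dot3 s v)"

lemma cross_prod_nth [simp]:
  "cross_prod u v $ 1 = u $ 2 * v $ 3 - u $ 3 * v $ 2"
  "cross_prod u v $ 2 = u $ 3 * v $ 1 - u $ 1 * v $ 3"
  "cross_prod u v $ 3 = u $ 1 * v $ 2 - u $ 2 * v $ 1"
  by (simp_all add: cross_prod_def)

lemmas vec3_simps = dot3_def sum_3 vec_eq_iff forall_3 matrix_vector_mult_def transpose_def trace_def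

lemma dot3_0 [simp]: "dot3 0 u = 0" "dot3 u 0 = 0"
  by (simp_all add: dot3_def)

lemma cross_prod_0 [simp]: "cross_prod 0 u = 0" "cross_prod u 0 = 0"
  by (simp_all add: vec_eq_iff forall_3)

lemma trace_0_nth: "trace A = 0 \<longleftrightarrow> A $ 3 $ 3 = - (A $ 1 $ 1) - (A $ 2 $ 2)" for A :: "'a::field^3^3"
  by (auto simp: trace_def sum_3 algebra_simps eq_neg_iff_add_eq_0)

lemma der_add: "der A s t (x + y) = der A s t x + der A s t y"
  by (cases x; cases y) (simp add: vec3_simps algebra_simps)

lemma der_zorn_scale: "der A s t (zorn_scale c x) = zorn_scale c (der A s t x)"
  by (cases x) (simp add: vec3_simps algebra_simps)

lemma der_zorn_mult:
  assumes "trace A = 0"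
  shows "der A s t (zorn_mult x y) = zorn_mult (der A s t x) y + zorn_mult x (der A s t y)"
  by (cases x; cases y) (simp add: assms[unfolded trace_0_nth] vec3_simps algebra_simps)

lemma der_in_split_g2: "trace A = 0 \<Longrightarrow> der A s t \<in> split_g2"
  unfolding split_g2_def by (blast intro: der_add der_zorn_scale der_zorn_mult)

text \<open>The relations of the idempotent \<open>(1, 0, 0, 0)\<close> with itself, with the unit
  and with the two middle components fix everything about \<open>D\<close> except \<open>s\<close>,
  \<open>t\<close> and two linear maps. Multiplication inside the middle components makes these maps
  dual and traceless.\<close>

lemma split_g2_eq: "split_g2 = {der A s t | A s t. trace A = (0 :: 'a::{field,ring_char_0})}"
proof (intro equalityI subsetI)
  fix D :: "'a zorn \<Rightarrow> 'a zorn" assume "D \<in> split_g2"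
  then have add: "D (x + y) = D x + D y" and scale: "D (zorn_scale c x) = zorn_scale c (D x)"
    and mult: "D (zorn_mult x y) = zorn_mult (D x) y + zorn_mult x (D y)" for x y c
    unfolding split_g2_def by blast+
  obtain a s t b where "D (1, 0, 0, 0) = (a, s, t, b)"
    by (metis surj_pair)
  with mult[of "(1, 0, 0, 0)" "(1, 0, 0, 0)"] have De: "D (1, 0, 0, 0) = (0, s, t, 0)"
    by simp
  obtain a' s' t' b' where "D (1, 0, 0, 1) = (a', s', t', b')"
    by (metis surj_pair)
  with mult[of "(1, 0, 0, 1)" "(1, 0, 0, 1)"] have "D (1, 0, 0, 1) = 0"
    by (simp add: zero_prod_def)
  with add[of "(1, 0, 0, 0)" "(0, 0, 0, 1)"] have Df: "D (0, 0, 0, 1) = (0, -s, -t, 0)"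
    by (simp add: De add_eq_0_iff)
  define g where "g u = fst (snd (D (0, u, 0, 0)))" for u
  define h where "h v = fst (snd (snd (D (0, 0, v, 0))))" for v
  have g_lin: "Vector_Spaces.linear (*s) (*s) g"
  proof (unfold_locales)
    show "g (u + u') = g u + g u'" for u u'
      using add[of "(0, u, 0, 0)" "(0, u', 0, 0)"] by (simp add: g_def)
    show "g (c *s u) = c *s g u" for c u
      using scale[of c "(0, u, 0, 0)"] by (cases "D (0, u, 0, 0)") (simp add: g_def)
  qed
  define A where "A = matrix g"
  have g: "g u = A *v u" for u
    unfolding A_def using matrix_works[OF g_lin] by simp
  have DU: "D (0, u, 0, 0) = (- dot3 t u, A *v u, cross_prod s u, dot3 t u)" for u
  proof -
    obtain a' u' v' b' where D: "D (0, u, 0, 0) = (a', u', v', b')"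
      by (metis surj_pair)
    with g[of u] have u': "u' = A *v u" by (simp add: g_def)
    \<comment> \<open>The idempotent acts on \<open>(0, u, 0, 0)\<close> as 1 from the left and as 0
      from the right. Differentiating both relations fixes every entry but the
      \<open>A\<close>-part; \<open>scale[of 0 0]\<close> supplies \<open>D 0 = 0\<close>.\<close>
    from mult[of "(1, 0, 0, 0)" "(0, u, 0, 0)"] mult[of "(0, u, 0, 0)" "(1, 0, 0, 0)"] scale[of 0 0]
    show ?thesis
      by (simp add: D De u' vec3_simps zero_prod_def algebra_simps eq_neg_iff_add_eq_0)
  qed
  have DV: "D (0, 0, v, 0) = (- dot3 s v, cross_prod t v, h v, dot3 s v)" for v
  proof -
    obtain a' u' v' b' where D: "D (0, 0, v, 0) = (a', u', v', b')"
      by (metis surj_pair)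
    then have v': "v' = h v" by (simp add: h_def)
    from mult[of "(0, 0, v, 0)" "(1, 0, 0, 0)"] mult[of "(1, 0, 0, 0)" "(0, 0, v, 0)"] scale[of 0 0]
    show ?thesis
      by (simp add: D De v' vec3_simps zero_prod_def algebra_simps eq_neg_iff_add_eq_0)
  qed
  \<comment> \<open>The product of \<open>u\<close> and \<open>v\<close> is \<open>dot3 u v\<close>
    times the idempotent, whose image has first entry 0.\<close>
  have adj: "dot3 (A *v u) v + dot3 u (h v) = 0" for u v
    using mult[of "(0, u, 0, 0)" "(0, 0, v, 0)"] scale[of "dot3 u v" "(1, 0, 0, 0)"]
    by (simp add: DU DV De vec3_simps)
  have h: "h v = - (transpose A *v v)" for v
    using adj[of "axis 1 1" v] adj[of "axis 2 1" v] adj[of "axis 3 1" v]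
    by (simp add: vec3_simps axis_def add_eq_0_iff)
  \<comment> \<open>The first two basis vectors of V multiply to the third one of V^*, on which
    \<open>D\<close> acts by minus the transpose; one entry of the product rule reads
    \<open>A11 + A22 = - A33\<close>.\<close>
  have "trace A = 0"
    using mult[of "(0, axis 1 1, 0, 0)" "(0, axis 2 1, 0, 0)"] DV[of "cross_prod (axis 1 1) (axis 2 1)"]
    by (simp add: DU h trace_0_nth vec3_simps axis_def algebra_simps)
  moreover have "D (a, u, v, b) = der A s t (a, u, v, b)" for a u v b
  proof -
    have "(a, u, v, b) = zorn_scale a (1, 0, 0, 0) + (0, u, 0, 0) + (0, 0, v, 0) + zorn_scale b (0, 0, 0, 1)"
      by (simp add: vec3_simps)
    then show ?thesis
      by (simp only: add scale De Df DU DV h) (simp add: vec3_simps algebra_simps)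
  qed
  ultimately show "D \<in> {der A s t | A s t. trace A = 0}"
    by fastforce
qed (use der_in_split_g2 in blast)

text \<open>The sl_3-component of a commutator. The scalar matrix at the end removes the trace of
  the rank-one terms coming from the pairing of V with V^*.\<close>

definition lie_A :: "'a::field^3^3 \<Rightarrow> 'a^3 \<Rightarrow> 'a^3 \<Rightarrow> 'a^3^3 \<Rightarrow> 'a^3 \<Rightarrow> 'a^3 \<Rightarrow> 'a^3^3" where
  "lie_A A s t A' s' t' = (\<chi> i j. (\<Sum>k\<in>UNIV. A $ i $ k * A' $ k $ j - A' $ i $ k * A $ k $ j)
     + 3 * (s' $ i * t $ j - s $ i * t' $ j) + (if i = j then dot3 s t' - dot3 t s' else 0))"

definition lie_s :: "'a::field^3^3 \<Rightarrow> 'a^3 \<Rightarrow> 'a^3 \<Rightarrow> 'a^3^3 \<Rightarrow> 'a^3 \<Rightarrow> 'a^3 \<Rightarrow> 'a^3" where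
  "lie_s A s t A' s' t' = A *v s' - A' *v s + 2 *s cross_prod t t'"

definition lie_t :: "'a::field^3^3 \<Rightarrow> 'a^3 \<Rightarrow> 'a^3 \<Rightarrow> 'a^3^3 \<Rightarrow> 'a^3 \<Rightarrow> 'a^3 \<Rightarrow> 'a^3" where
  "lie_t A s t A' s' t' = transpose A' *v t - transpose A *v t' + 2 *s cross_prod s s'"

lemma commutator_der:
  assumes "trace A = 0" "trace A' = 0"
  shows "commutator (der A s t) (der A' s' t')
    = der (lie_A A s t A' s' t') (lie_s A s t A' s' t') (lie_t A s t A' s' t')"
proof
  show "commutator (der A s t) (der A' s' t') x
    = der (lie_A A s t A' s' t') (lie_s A s t A' s' t') (lie_t A s t A' s' t') x" for x
    by (cases x) (simp add: assms[unfolded trace_0_nth] commutator_def lie_A_def lie_s_def lie_t_def vec3_simps algebra_simps)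
qed

lemma trace_lie_A: "trace (lie_A A s t A' s' t') = 0"
  by (simp add: lie_A_def vec3_simps algebra_simps)

section \<open>Vector fields on the quadric of null imaginary octonions\<close>

text \<open>The eight coordinate functionals of the Zorn algebra: calculus on Zorn-valued maps is
  reduced to scalar functions by applying them.\<close>

definition zproj :: "('a zorn \<Rightarrow> 'a) set" where
  "zproj = {fst, \<lambda>z. snd (snd (snd z))} \<union> range (\<lambda>i z. fst (snd z) $ i)
     \<union> range (\<lambda>i z. fst (snd (snd z)) $ i)"

lemma zproj_simps [simp]: "fst \<in> zproj" "(\<lambda>z. snd (snd (snd z))) \<in> zproj"
  "(\<lambda>z. fst (snd z) $ i) \<in> zproj" "(\<lambda>z. fst (snd (snd z)) $ i) \<in> zproj"
  by (auto simp: zproj_def)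

lemma zproj_eqI:
  assumes "\<And>\<pi>. \<pi> \<in> zproj \<Longrightarrow> \<pi> x = \<pi> y"
  shows "x = y"
  using assms[OF zproj_simps(1)] assms[OF zproj_simps(2)] assms[OF zproj_simps(3)] assms[OF zproj_simps(4)]
  by (simp add: prod_eq_iff vec_eq_iff)

lemma bounded_linear_zproj: "\<pi> \<in> zproj \<Longrightarrow> bounded_linear (\<pi> :: 'a::real_normed_field zorn \<Rightarrow> 'a)"
  unfolding zproj_def
  by (auto intro!: bounded_linear_fst bounded_linear_snd
      bounded_linear_compose[OF bounded_linear_vec_nth] bounded_linear_compose[OF bounded_linear_fst]
      bounded_linear_compose[OF bounded_linear_snd])

lemma zproj_zorn_scale: "\<pi> \<in> zproj \<Longrightarrow> \<pi> (zorn_scale c x) = c * \<pi> x"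
  by (cases x) (auto simp: zproj_def)

lemma zproj_add: "\<pi> \<in> zproj \<Longrightarrow> \<pi> (x + y) = \<pi> x + \<pi> y"
  by (auto simp: zproj_def)

lemma zproj_diff: "\<pi> \<in> zproj \<Longrightarrow> \<pi> (x - y) = \<pi> x - (\<pi> y :: 'a::ab_group_add)"
  by (auto simp: zproj_def)

lemma differentiable_Pair:
  "f differentiable (at x) \<Longrightarrow> g differentiable (at x) \<Longrightarrow> (\<lambda>x. (f x, g x)) differentiable (at x)"
  using has_derivative_Pair unfolding differentiable_def by blast

definition regular_zorn :: "('a::real_normed_field^'n) set \<Rightarrow> ('a^'n \<Rightarrow> 'a zorn) \<Rightarrow> bool" where
  "regular_zorn U \<Psi> \<longleftrightarrow> (\<forall>\<pi>\<in>zproj. regular U (\<lambda>x. \<pi> (\<Psi> x)))"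

lemma regular_zorn_differentiable:
  assumes "open U" "regular_zorn U \<Psi>" "x \<in> U"
  shows "\<Psi> differentiable (at x)"
proof -
  have proj: "(\<lambda>x. \<pi> (\<Psi> x)) differentiable (at x)" if "\<pi> \<in> zproj" for \<pi>
    using assms that by (auto simp: regular_zorn_def intro: regular_differentiable)
  have "(\<lambda>x. (fst (\<Psi> x), fst (snd (\<Psi> x)), fst (snd (snd (\<Psi> x))), snd (snd (snd (\<Psi> x)))))
      differentiable (at x)"
    using proj[of fst] proj[of "\<lambda>z. snd (snd (snd z))"]
      proj[of "\<lambda>z. fst (snd z) $ i" for i] proj[of "\<lambda>z. fst (snd (snd z)) $ i" for i]
    by (intro differentiable_Pair differentiable_vecI) simp_all
  then show ?thesis by simp
qed

lemma zproj_vf_apply: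
  fixes \<Psi> :: "'a::real_normed_field^'n \<Rightarrow> 'a zorn"
  assumes "\<pi> \<in> zproj" "\<Psi> differentiable (at x)"
  shows "\<pi> (vf_apply X \<Psi> x) = vf_apply X (\<lambda>x. \<pi> (\<Psi> x)) x"
  unfolding vf_apply_def
  using frechet_derivative_bounded_linear[OF bounded_linear_zproj[OF assms(1)] assms(2)] by simp

lemma regular_zorn_vf_apply:
  assumes "open U" "regular_zorn U \<Psi>" "regular_field U X"
  shows "regular_zorn U (vf_apply X \<Psi>)"
  unfolding regular_zorn_def
proof
  fix \<pi> :: "'a zorn \<Rightarrow> 'a" assume \<pi>: "\<pi> \<in> zproj"
  then have "regular U (vf_apply X (\<lambda>x. \<pi> (\<Psi> x)))"
    using assms by (intro regular_vf_apply) (auto simp: regular_zorn_def)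
  then show "regular U (\<lambda>x. \<pi> (vf_apply X \<Psi> x))"
    by (rule regular.cong) (rule zproj_vf_apply[OF \<pi> regular_zorn_differentiable[OF assms(1,2)]])
qed

lemma vf_apply_lie_bracket_zorn:
  assumes "open U" "regular_field U X" "regular_field U Y" "regular_zorn U \<Psi>" "x \<in> U"
  shows "vf_apply (lie_bracket U X Y) \<Psi> x = vf_apply X (vf_apply Y \<Psi>) x - vf_apply Y (vf_apply X \<Psi>) x"
proof (rule zproj_eqI)
  fix \<pi> :: "'a zorn \<Rightarrow> 'a" assume \<pi>: "\<pi> \<in> zproj"
  have *: "\<pi> (vf_apply X (vf_apply Y \<Psi>) x) = vf_apply X (vf_apply Y (\<lambda>x. \<pi> (\<Psi> x))) x"
    if "regular_field U Y" for X Y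
  proof -
    have "\<pi> (vf_apply X (vf_apply Y \<Psi>) x) = vf_apply X (\<lambda>x. \<pi> (vf_apply Y \<Psi> x)) x"
      using assms that by (intro zproj_vf_apply[OF \<pi>] regular_zorn_differentiable regular_zorn_vf_apply)
    also have "\<dots> = vf_apply X (vf_apply Y (\<lambda>x. \<pi> (\<Psi> x))) x"
      by (intro vf_apply_cong_open[OF assms(1,5)] zproj_vf_apply[OF \<pi>] regular_zorn_differentiable[OF assms(1,4)])
    finally show ?thesis .
  qed
  have "\<pi> (vf_apply (lie_bracket U X Y) \<Psi> x) = vf_apply (lie_bracket U X Y) (\<lambda>x. \<pi> (\<Psi> x)) x"
    by (rule zproj_vf_apply[OF \<pi> regular_zorn_differentiable[OF assms(1,4,5)]])
  also have "\<dots> = vf_apply X (vf_apply Y (\<lambda>x. \<pi> (\<Psi> x))) x - vf_apply Y (vf_apply X (\<lambda>x. \<pi> (\<Psi> x))) x"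
    using \<pi> assms by (intro vf_apply_lie_bracket) (auto simp: regular_zorn_def)
  finally show "\<pi> (vf_apply (lie_bracket U X Y) \<Psi> x)
      = \<pi> (vf_apply X (vf_apply Y \<Psi>) x - vf_apply Y (vf_apply X \<Psi>) x)"
    by (simp add: * assms zproj_diff[OF \<pi>])
qed

lemma vf_apply_zorn_scale:
  fixes \<Psi> :: "'a::real_normed_field^'n \<Rightarrow> 'a zorn"
  assumes "f differentiable (at x)" "\<Psi> differentiable (at x)"
    "(\<lambda>x. zorn_scale (f x) (\<Psi> x)) differentiable (at x)"
  shows "vf_apply X (\<lambda>x. zorn_scale (f x) (\<Psi> x)) x
    = zorn_scale (f x) (vf_apply X \<Psi> x) + zorn_scale (vf_apply X f x) (\<Psi> x)"
proof (rule zproj_eqI)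
  fix \<pi> :: "'a zorn \<Rightarrow> 'a" assume \<pi>: "\<pi> \<in> zproj"
  have "(\<lambda>x. \<pi> (\<Psi> x)) differentiable (at x)"
    using bounded_linear.has_derivative[OF bounded_linear_zproj[OF \<pi>]] assms(2)
    unfolding differentiable_def by blast
  then show "\<pi> (vf_apply X (\<lambda>x. zorn_scale (f x) (\<Psi> x)) x)
    = \<pi> (zorn_scale (f x) (vf_apply X \<Psi> x) + zorn_scale (vf_apply X f x) (\<Psi> x))"
    by (simp add: zproj_vf_apply[OF \<pi> assms(3)] zproj_zorn_scale[OF \<pi>]
        zproj_add[OF \<pi>] zproj_vf_apply[OF \<pi> assms(2)])
      (simp add: vf_apply_def frechet_derivative_mult[OF assms(1)])
qed

lemma bounded_linear_der: "bounded_linear (der A s t :: 'a::real_normed_field zorn \<Rightarrow> 'a zorn)"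
proof -
  have eq: "der A s t = (\<lambda>z. (- dot3 t (fst (snd z)) - dot3 s (fst (snd (snd z))),
      (fst z - snd (snd (snd z))) *s s + A *v fst (snd z) + cross_prod t (fst (snd (snd z))),
      (fst z - snd (snd (snd z))) *s t + cross_prod s (fst (snd z)) - transpose A *v fst (snd (snd z)),
      dot3 t (fst (snd z)) + dot3 s (fst (snd (snd z)))))"
    by (rule ext) (metis der.simps prod.collapse)
  have nth: "bounded_linear (\<lambda>z :: 'a zorn. fst (snd z) $ i)"
    "bounded_linear (\<lambda>z :: 'a zorn. fst (snd (snd z)) $ i)"
    "bounded_linear (\<lambda>z :: 'a zorn. snd (snd (snd z)))" for i
    by (auto intro: bounded_linear_zproj simp: zproj_def)
  have vec: "bounded_linear f"
    if "bounded_linear (\<lambda>x. f x $ 1)" "bounded_linear (\<lambda>x. f x $ 2)" "bounded_linear (\<lambda>x. f x $ 3)"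
    for f :: "'a zorn \<Rightarrow> 'a^3"
  proof (rule bounded_linear_vecI)
    show "bounded_linear (\<lambda>x. f x $ i)" for i
      using exhaust_3[of i] that by auto
  qed
  show ?thesis
    unfolding eq
    by (intro bounded_linear_Pair vec;
        simp add: dot3_def sum_3 matrix_vector_mult_def del: transpose_matrix_vector;
        intro bounded_linear_add bounded_linear_sub bounded_linear_minus bounded_linear_const_mult
          bounded_linear_mult_const bounded_linear_fst nth)
qed

lemma der_diff: "der A s t (x - y) = der A s t x - der A s t y"
  by (cases x; cases y) (simp add: vec3_simps algebra_simps)

definition zlead :: "'a zorn \<Rightarrow> 'a" where
  "zlead z = fst (snd z) $ 1"

lemma zlead_zproj: "zlead \<in> zproj"
  unfolding zlead_def[abs_def] zproj_def by blast

lemmas zlead_simps = zproj_add[OF zlead_zproj] zproj_diff[OF zlead_zproj]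
  zproj_zorn_scale[OF zlead_zproj]

text \<open>
  \<open>X\<close> is the pullback along \<open>\<Psi>\<close> of the vector field which \<open>- D\<close> induces on the projectivized
  quadric, in the affine chart where the coordinate \<open>zlead\<close> is \<open>1\<close>. The sign turns the
  antihomomorphism from derivations to vector fields into a homomorphism.
\<close>

definition related :: "('a::real_normed_field^5) set \<Rightarrow> ('a^5 \<Rightarrow> 'a zorn) \<Rightarrow> 'a vfield \<Rightarrow>
    ('a zorn \<Rightarrow> 'a zorn) \<Rightarrow> bool" where
  "related U \<Psi> X D \<longleftrightarrow> regular_field U X \<and> (\<forall>x. x \<notin> U \<longrightarrow> X x = 0) \<and>
     (\<forall>x\<in>U. vf_apply X \<Psi> x = zorn_scale (zlead (D (\<Psi> x))) (\<Psi> x) - D (\<Psi> x))"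

lemma zorn_scale_simps:
  "zorn_scale (a + b) x = zorn_scale a x + zorn_scale b x"
  "zorn_scale (a - b) x = zorn_scale a x - zorn_scale b x"
  "zorn_scale a (x + y) = zorn_scale a x + zorn_scale a y"
  "zorn_scale a (x - y) = zorn_scale a x - zorn_scale a y"
  "zorn_scale a (zorn_scale b x) = zorn_scale (a * b) x"
  "zorn_scale 1 x = x"
  by (cases x; cases y; simp add: vec_eq_iff algebra_simps)+

text \<open>Write \<open>D\<close> and \<open>E\<close> for the two derivations. In the double
  derivative of \<open>\<Psi>\<close>, the terms with a product of two \<open>zlead\<close> factors
  and the mixed terms \<open>zlead (E \<Psi>) * D \<Psi>\<close> plus
  \<open>zlead (D \<Psi>) * E \<Psi>\<close> are symmetric, so they cancel in the bracket. What
  survives is the formula for \<open>D E - E D\<close>.\<close>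

lemma related_bracket:
  assumes "open U" "regular_zorn U \<Psi>" "related U \<Psi> X (der A s t)" "related U \<Psi> Y (der A' s' t')"
  shows "related U \<Psi> (lie_bracket U X Y) (commutator (der A s t) (der A' s' t'))"
proof -
  have apply_apply: "vf_apply X (vf_apply Y \<Psi>) x =
      zorn_scale (zlead (E (\<Psi> x)) * zlead (D (\<Psi> x))) (\<Psi> x)
      + zorn_scale (zlead (D (\<Psi> x)) * zlead (E (\<Psi> x))) (\<Psi> x) - zorn_scale (zlead (E (D (\<Psi> x)))) (\<Psi> x)
      - zorn_scale (zlead (E (\<Psi> x))) (D (\<Psi> x)) - zorn_scale (zlead (D (\<Psi> x))) (E (\<Psi> x)) + E (D (\<Psi> x))"
    if x: "x \<in> U" and X: "related U \<Psi> X D" and Y: "related U \<Psi> Y E"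
      and E: "E = der A s t" for X Y D E A s t x
  proof -
    have \<Psi>: "\<Psi> differentiable (at x)"
      using regular_zorn_differentiable[OF assms(1,2) x] .
    have bl: "bounded_linear E" "bounded_linear (\<lambda>z. zlead (E z))"
      using bounded_linear_der bounded_linear_compose[OF bounded_linear_zproj[OF zlead_zproj] bounded_linear_der]
      unfolding E by auto
    have diff: "(\<lambda>x. E (\<Psi> x)) differentiable (at x)" "(\<lambda>x. zlead (E (\<Psi> x))) differentiable (at x)"
      using bl[THEN bounded_linear.has_derivative] \<Psi> unfolding differentiable_def by blast+
    \<comment> \<open>Differentiability of the product term is read off from the other two: on
      \<open>U\<close> it equals \<open>vf_apply Y \<Psi> + E \<Psi>\<close>.\<close>
    have "vf_apply Y \<Psi> differentiable (at x)"
      using Y by (intro regular_zorn_differentiable[OF assms(1) regular_zorn_vf_apply] assms x)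
        (simp_all add: related_def)
    then have "(\<lambda>x. vf_apply Y \<Psi> x + E (\<Psi> x)) differentiable (at x)"
      using diff by (intro differentiable_add)
    then have diff': "(\<lambda>x. zorn_scale (zlead (E (\<Psi> x))) (\<Psi> x)) differentiable (at x)"
      using Y by (elim differentiable_cong_open[OF assms(1) x, rotated]) (simp add: related_def)
    have "vf_apply X (vf_apply Y \<Psi>) x = vf_apply X (\<lambda>x. zorn_scale (zlead (E (\<Psi> x))) (\<Psi> x) - E (\<Psi> x)) x"
      using Y by (intro vf_apply_cong_open[OF assms(1) x]) (simp add: related_def)
    also have "\<dots> = vf_apply X (\<lambda>x. zorn_scale (zlead (E (\<Psi> x))) (\<Psi> x)) x - vf_apply X (\<lambda>x. E (\<Psi> x)) x"
      unfolding vf_apply_def by (rule frechet_derivative_diff[OF diff' diff(1)])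
    also have "\<dots> = zorn_scale (zlead (E (\<Psi> x))) (vf_apply X \<Psi> x)
        + zorn_scale (zlead (E (vf_apply X \<Psi> x))) (\<Psi> x) - E (vf_apply X \<Psi> x)"
      unfolding vf_apply_zorn_scale[OF diff(2) \<Psi> diff']
      unfolding vf_apply_def frechet_derivative_bounded_linear[OF bl(1) \<Psi>]
        frechet_derivative_bounded_linear[OF bl(2) \<Psi>] ..
    finally show ?thesis
      using X x unfolding related_def
      by (simp add: der_diff E der_zorn_scale zlead_simps zorn_scale_simps)
  qed
  have "vf_apply (lie_bracket U X Y) \<Psi> x = zorn_scale (zlead (commutator (der A s t) (der A' s' t') (\<Psi> x))) (\<Psi> x)
      - commutator (der A s t) (der A' s' t') (\<Psi> x)" if "x \<in> U" for x
    using assms that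
    by (subst vf_apply_lie_bracket_zorn)
      (simp_all add: related_def[of U \<Psi> X] related_def[of U \<Psi> Y] apply_apply[OF that assms(3,4) refl]
        apply_apply[OF that assms(4,3) refl] commutator_def zlead_simps zorn_scale_simps mult.commute)
  then show ?thesis
    using assms regular_field_lie_bracket
    by (auto simp: related_def lie_bracket_def restrict_to_def)
qed

lemma related_add:
  assumes "open U" "regular_zorn U \<Psi>" "related U \<Psi> X D" "related U \<Psi> Y E"
  shows "related U \<Psi> (X + Y) (D + E)"
proof -
  have "vf_apply (X + Y) \<Psi> x = vf_apply X \<Psi> x + vf_apply Y \<Psi> x" if "x \<in> U" for x
    using linear_add[OF linear_frechet_derivative[OF regular_zorn_differentiable[OF assms(1,2) that]]]
    by (simp add: vf_apply_def)
  then show ?thesis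
    using assms(3,4) unfolding related_def regular_field_def
    by (auto simp: zlead_simps zorn_scale_simps intro: regular.add)
qed

lemma related_scale:
  assumes "open U" "regular_zorn U \<Psi>" "related U \<Psi> X D"
  shows "related U \<Psi> (vf_scale c X) (end_scale c D)"
proof -
  have "vf_apply (vf_scale c X) \<Psi> x = zorn_scale c (vf_apply X \<Psi> x)" if "x \<in> U" for x
  proof (rule zproj_eqI)
    fix \<pi> :: "'a zorn \<Rightarrow> 'a" assume \<pi>: "\<pi> \<in> zproj"
    then show "\<pi> (vf_apply (vf_scale c X) \<Psi> x) = \<pi> (zorn_scale c (vf_apply X \<Psi> x))"
      using assms(1,2) that
      by (simp add: zproj_vf_apply[OF \<pi> regular_zorn_differentiable[OF assms(1,2)]] zproj_zorn_scale[OF \<pi>])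
        (simp add: vf_apply_def vf_scale_def regular_zorn_def regular_derivative_scale)
  qed
  then show ?thesis
    using assms(3) unfolding related_def regular_field_def
    by (auto simp: zlead_simps zorn_scale_simps vf_scale_def end_scale_def mult.assoc
        intro: regular.mult regular.const)
qed

section \<open>Realizing all derivations by vector fields\<close>

lemma vector_space_vf_scale: "vector_space vf_scale"
  by unfold_locales (auto simp: vf_scale_def fun_eq_iff vec_eq_iff algebra_simps)

definition mat_scale :: "'a::times \<Rightarrow> 'a^'n^'m \<Rightarrow> 'a^'n^'m" where
  "mat_scale c A = (\<chi> i j. c * A $ i $ j)"

lemma mat_scale_nth [simp]: "mat_scale c A $ i $ j = c * A $ i $ j"
  by (simp add: mat_scale_def)

definition mat_unit :: "'n \<Rightarrow> 'm \<Rightarrow> 'a::zero \<Rightarrow> 'a^'m^'n" where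
  "mat_unit i j c = axis i (axis j c)"

lemma mat_unit_nth: "mat_unit i j c $ k $ l = (if i = k \<and> j = l then c else 0)"
  by (simp add: mat_unit_def axis_def)

lemma trace_mat_unit [simp]: "i \<noteq> j \<Longrightarrow> trace (mat_unit i j c) = 0"
  unfolding trace_def by (rule sum.neutral) (auto simp: mat_unit_nth)

lemma trace_zero [simp]: "trace (0 :: 'a::semiring_1^'n^'n) = 0"
  by (simp add: trace_def)

lemma der_plus: "der A s t + der A' s' t' = der (A + A') (s + s') (t + t')"
proof
  show "(der A s t + der A' s' t') x = der (A + A') (s + s') (t + t') x" for x
    by (cases x) (simp add: vec3_simps algebra_simps)
qed

lemma end_scale_der: "end_scale c (der A s t) = der (mat_scale c A) (c *s s) (c *s t)"
proof
  show "end_scale c (der A s t) x = der (mat_scale c A) (c *s s) (c *s t) x" for x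
    by (cases x) (simp add: end_scale_def vec3_simps algebra_simps)
qed

lemma trace_mat_scale: "trace (mat_scale c A) = c * trace A" for A :: "'a::semiring_1^'n^'n"
  by (simp add: trace_def sum_distrib_left)

lemma lie_bracket_0_left:
  assumes "open U" "regular_field U X"
  shows "lie_bracket U (\<lambda>_. 0) X = (\<lambda>_. 0)"
proof
  show "lie_bracket U (\<lambda>_. 0) X x = 0" for x
    using linear_0[OF linear_frechet_derivative[OF regular_field_differentiable[OF assms]], of x]
      frechet_derivative_eqI[OF has_derivative_const, of "0 :: 'a^5" x]
    by (simp add: lie_bracket_def restrict_to_def)
qed

text \<open>Everything the algebraic part uses about the immersion. The three realized derivations
  form a basis of V and generate the rest; \<open>nontrivial\<close> is the one nonvanishing fact
  from which triviality of the kernel is derived.\<close>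

locale g2_chart =
  fixes U :: "('a::real_normed_field^5) set" and \<Psi> :: "'a^5 \<Rightarrow> 'a zorn"
  assumes open_U: "open U" and \<Psi>: "regular_zorn U \<Psi>"
    and \<Psi>_immersion: "x \<in> U \<Longrightarrow> frechet_derivative \<Psi> (at x) v = 0 \<Longrightarrow> v = 0"
    and simple_roots: "\<exists>X. related U \<Psi> X (der 0 (axis i 1) 0)"
    and nontrivial: "\<not> related U \<Psi> (\<lambda>_. 0) (der 0 (axis 2 1) 0)"
begin

lemma related_unique:
  assumes "related U \<Psi> X D" "related U \<Psi> Y D"
  shows "X = Y"
proof
  fix x
  show "X x = Y x"
  proof (cases "x \<in> U")
    case True
    then have "frechet_derivative \<Psi> (at x) (X x - Y x) = 0"
      using assms linear_diff[OF linear_frechet_derivative[OF regular_zorn_differentiable[OF open_U \<Psi> True]]]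
      by (simp add: related_def vf_apply_def)
    then show ?thesis using \<Psi>_immersion[OF True] by force
  qed (use assms in \<open>simp add: related_def\<close>)
qed

section \<open>Generating all derivations from V\<close>

definition realizable :: "'a^3^3 \<Rightarrow> 'a^3 \<Rightarrow> 'a^3 \<Rightarrow> bool" where
  "realizable A s t \<longleftrightarrow> trace A = 0 \<and> (\<exists>X. related U \<Psi> X (der A s t))"

lemma realizable_add: "realizable A s t \<Longrightarrow> realizable A' s' t' \<Longrightarrow> realizable (A + A') (s + s') (t + t')"
  unfolding realizable_def using related_add[OF open_U \<Psi>] by (metis der_plus trace_add add.left_neutral)

lemma realizable_scale: "realizable A s t \<Longrightarrow> realizable (mat_scale c A) (c *s s) (c *s t)"
  unfolding realizable_def using related_scale[OF open_U \<Psi>]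
  by (metis end_scale_der trace_mat_scale mult_zero_right)

lemma realizable_bracket:
  "realizable A s t \<Longrightarrow> realizable A' s' t' \<Longrightarrow>
    realizable (lie_A A s t A' s' t') (lie_s A s t A' s' t') (lie_t A s t A' s' t')"
  unfolding realizable_def using related_bracket[OF open_U \<Psi>] by (metis commutator_der trace_lie_A)

lemma realizable_0: "realizable 0 0 0"
  using realizable_scale[of 0 "axis 1 1" 0 0] simple_roots[of 1]
  by (simp add: realizable_def trace_def mat_scale_def zero_vec_def)

lemma realizable_sum:
  "(\<And>i. i \<in> I \<Longrightarrow> realizable (A i) (s i) (t i)) \<Longrightarrow> realizable (\<Sum>i\<in>I. A i) (\<Sum>i\<in>I. s i) (\<Sum>i\<in>I. t i)"
  by (induction I rule: infinite_finite_induct) (auto intro: realizable_0 realizable_add)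

lemma realizable_s: "realizable 0 s 0"
proof -
  have "realizable (mat_scale (s $ i) 0) (s $ i *s axis i 1) (s $ i *s 0)" for i
    by (intro realizable_scale) (simp add: realizable_def simple_roots trace_def)
  then have "realizable (\<Sum>i\<in>UNIV. mat_scale (s $ i) 0) (\<Sum>i\<in>UNIV. s $ i *s axis i 1) (\<Sum>i\<in>UNIV. s $ i *s 0)"
    by (intro realizable_sum) blast
  then show ?thesis by (simp add: basis_expansion mat_scale_def zero_vec_def[symmetric])
qed

text \<open>Two elements of V have bracket \<open>2 * cross_prod s s'\<close> in V^*, and each
  \<open>t\<close> is a sum of three such cross products of coordinate vectors.\<close>

lemma realizable_t: "realizable 0 0 t"
proof -
  have "realizable 0 0 (cross_prod s s')" for s s'
    using realizable_scale[OF realizable_bracket[OF realizable_s[of s] realizable_s[of s']], of "1/2"]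
    by (simp add: lie_A_def lie_s_def lie_t_def mat_scale_def zero_vec_def[symmetric] if_distrib cong: if_cong)
  from realizable_add[OF realizable_add[OF this[of "axis 2 (t $ 1)" "axis 3 1"] this[of "axis 3 (t $ 2)" "axis 1 1"]]
      this[of "axis 1 (t $ 3)" "axis 2 1"]]
  have "realizable 0 0 (cross_prod (axis 2 (t $ 1)) (axis 3 1) + cross_prod (axis 3 (t $ 2)) (axis 1 1)
      + cross_prod (axis 1 (t $ 3)) (axis 2 1))"
    by simp
  also have "cross_prod (axis 2 (t $ 1)) (axis 3 1) + cross_prod (axis 3 (t $ 2)) (axis 1 1)
      + cross_prod (axis 1 (t $ 3)) (axis 2 1) = t"
    by (simp add: vec3_simps axis_def)
  finally show ?thesis .
qed

lemma realizable_A: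
  assumes "trace A = 0"
  shows "realizable A 0 0"
proof -
  \<comment> \<open>\<open>?M i\<close> is \<open>- 3\<close> times the matrix whose only nonzero
    row is row \<open>i\<close> of \<open>A\<close>, plus the scalar matrix
    \<open>A $ i $ i\<close>. The sum over \<open>i\<close> is \<open>- 3 A\<close> plus the trace,
    which is 0.\<close>
  let ?M = "\<lambda>i. lie_A 0 (axis i 1) 0 0 0 (A $ i)"
  have "realizable (?M i) 0 0" for i
    using realizable_bracket[OF realizable_s[of "axis i 1"] realizable_t[of "A $ i"]]
    by (simp add: lie_s_def lie_t_def)
  then have "realizable (mat_scale (- 1/3) (?M 1 + ?M 2 + ?M 3)) 0 0"
    by (metis realizable_scale[of _ 0 0] realizable_add[of _ 0 0 _ 0 0] add.left_neutral vector_smult_rzero)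
  also have "mat_scale (- 1/3) (?M 1 + ?M 2 + ?M 3) = A"
    using assms unfolding trace_0_nth by (simp add: lie_A_def vec3_simps axis_def, simp add: field_simps)
  finally show ?thesis .
qed

lemma realizable_iff: "realizable A s t \<longleftrightarrow> trace A = 0"
proof
  assume "trace A = 0"
  then show "realizable A s t"
    using realizable_add[OF realizable_add[OF realizable_A[of A] realizable_s[of s]] realizable_t[of t]]
    by simp
qed (simp add: realizable_def)

text \<open>Meaningful for traceless \<open>A\<close>: existence comes from
  \<open>realizable_iff\<close>, uniqueness from \<open>related_unique\<close>.\<close>

definition fld :: "'a^3^3 \<Rightarrow> 'a^3 \<Rightarrow> 'a^3 \<Rightarrow> 'a vfield" where
  "fld A s t = (THE X. related U \<Psi> X (der A s t))"

lemma fld_eqI: "related U \<Psi> X (der A s t) \<Longrightarrow> fld A s t = X"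
  unfolding fld_def using related_unique by blast

lemma related_fld: "trace A = 0 \<Longrightarrow> related U \<Psi> (fld A s t) (der A s t)"
  using realizable_iff[of A s t] fld_eqI unfolding realizable_def by metis

lemma fld_add:
  "trace A = 0 \<Longrightarrow> trace A' = 0 \<Longrightarrow> fld A s t + fld A' s' t' = fld (A + A') (s + s') (t + t')"
  using related_add[OF open_U \<Psi> related_fld related_fld] fld_eqI by (metis der_plus)

lemma fld_scale: "trace A = 0 \<Longrightarrow> vf_scale c (fld A s t) = fld (mat_scale c A) (c *s s) (c *s t)"
  using related_scale[OF open_U \<Psi> related_fld] fld_eqI by (metis end_scale_der)

lemma fld_bracket:
  "trace A = 0 \<Longrightarrow> trace A' = 0 \<Longrightarrow> lie_bracket U (fld A s t) (fld A' s' t')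
    = fld (lie_A A s t A' s' t') (lie_s A s t A' s' t') (lie_t A s t A' s' t')"
  using related_bracket[OF open_U \<Psi> related_fld related_fld] fld_eqI by (metis commutator_der)

lemma fld_0: "fld 0 0 0 = 0"
  using fld_scale[of 0 0 0 0] by (simp add: trace_def mat_scale_def vf_scale_def zero_vec_def[symmetric] zero_fun_def)

section \<open>Triviality of the kernel\<close>

definition ker :: "'a^3^3 \<Rightarrow> 'a^3 \<Rightarrow> 'a^3 \<Rightarrow> bool" where
  "ker A s t \<longleftrightarrow> trace A = 0 \<and> fld A s t = 0"

lemma ker_bracket:
  assumes "ker A s t" "trace A' = 0"
  shows "ker (lie_A A s t A' s' t') (lie_s A s t A' s' t') (lie_t A s t A' s' t')"
proof -
  have "regular_field U (fld A' s' t')"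
    using related_fld[OF assms(2)] by (simp add: related_def)
  with assms fld_bracket[of A A' s t s' t'] lie_bracket_0_left[OF open_U]
  show ?thesis by (simp add: ker_def trace_lie_A zero_fun_def)
qed

lemma ker_axis_2: "ker 0 (axis 2 c) 0 \<Longrightarrow> c = 0"
proof (rule ccontr)
  assume ker: "ker 0 (axis 2 c) 0" and "c \<noteq> 0"
  then have "fld 0 (axis 2 1) 0 = 0"
    using fld_scale[of 0 "inverse c" "axis 2 c" 0]
    by (simp add: ker_def mat_scale_def vf_scale_def zero_vec_def[symmetric] zero_fun_def axis_def
        vector_scalar_mult_def if_distrib cong: if_cong)
  with related_fld[of 0 "axis 2 1" 0] nontrivial show False
    by (simp add: trace_def zero_fun_def)
qed

text \<open>The elementary matrix with entry at \<open>(2, i)\<close> carries the line of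
  \<open>axis i\<close> to that of \<open>axis 2\<close>, where the assumption
  \<open>nontrivial\<close> applies.\<close>

lemma ker_axis: "ker 0 (axis i c) 0 \<Longrightarrow> c = 0"
proof (cases "i = 2")
  case False
  assume "ker 0 (axis i c) 0"
  with False have "ker (lie_A 0 (axis i c) 0 (mat_unit 2 i 1) 0 0) (lie_s 0 (axis i c) 0 (mat_unit 2 i 1) 0 0)
      (lie_t 0 (axis i c) 0 (mat_unit 2 i 1) 0 0)"
    by (intro ker_bracket) auto
  also have "lie_A 0 (axis i c) 0 (mat_unit 2 i 1) 0 0 = 0"
    by (simp add: lie_A_def vec_eq_iff)
  also have "lie_t 0 (axis i c) 0 (mat_unit 2 i 1) 0 0 = 0"
    by (simp add: lie_t_def)
  also have "lie_s 0 (axis i c) 0 (mat_unit 2 i 1) 0 0 = axis 2 (- c)"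
    using False exhaust_3[of i] by (auto simp: lie_s_def vec3_simps mat_unit_nth axis_def)
  finally show ?thesis using ker_axis_2 by fastforce
qed (use ker_axis_2 in simp)

text \<open>The bracket with \<open>axis j 1\<close> in V moves the elementary matrix to
  \<open>axis i c\<close> in V.\<close>

lemma ker_mat_unit:
  assumes "ker (mat_unit i j c) 0 0" "i \<noteq> j"
  shows "c = 0"
proof -
  have "lie_A (mat_unit i j c) 0 0 0 (axis j 1) 0 = 0" "lie_t (mat_unit i j c) 0 0 0 (axis j 1) 0 = 0"
    by (simp_all add: lie_A_def lie_t_def vec_eq_iff)
  moreover have "lie_s (mat_unit i j c) 0 0 0 (axis j 1) 0 = axis i c"
    using exhaust_3[of i] exhaust_3[of j] by (auto simp: lie_s_def vec3_simps mat_unit_nth axis_def)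
  ultimately show ?thesis
    using ker_bracket[OF assms(1), of 0 "axis j 1" 0] ker_axis[of i c] by (simp add: trace_def)
qed

text \<open>The square of the adjoint action of an elementary matrix \<open>E\<^sub>i\<^sub>j\<close> isolates the
  entry \<open>A\<^sub>j\<^sub>i\<close>.\<close>

lemma ker_offdiag:
  assumes "ker A s t" "i \<noteq> j"
  shows "A $ j $ i = 0"
proof -
  let ?E = "mat_unit i j 1"
  have tr: "trace ?E = 0"
    using assms(2) by simp
  define B s1 t1 where "B = lie_A A s t ?E 0 0" and "s1 = lie_s A s t ?E 0 0" and "t1 = lie_t A s t ?E 0 0"
  have "ker (lie_A B s1 t1 ?E 0 0) (lie_s B s1 t1 ?E 0 0) (lie_t B s1 t1 ?E 0 0)"
    unfolding B_def s1_def t1_def by (intro ker_bracket assms(1) tr)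
  also have "lie_A B s1 t1 ?E 0 0 = mat_unit i j (- 2 * A $ j $ i)"
    using assms(2) exhaust_3[of i] exhaust_3[of j]
    by (auto simp: B_def lie_A_def vec3_simps mat_unit_nth)
  also have "lie_s B s1 t1 ?E 0 0 = 0"
    using assms(2) exhaust_3[of i] exhaust_3[of j]
    by (auto simp: s1_def lie_s_def vec3_simps mat_unit_nth)
  also have "lie_t B s1 t1 ?E 0 0 = 0"
    using assms(2) exhaust_3[of i] exhaust_3[of j]
    by (auto simp: t1_def lie_t_def vec3_simps mat_unit_nth)
  finally show ?thesis using ker_mat_unit[of i j] assms(2) by fastforce
qed

lemma ker_trivial:
  assumes "ker A s t"
  shows "A = 0 \<and> s = 0 \<and> t = 0"
proof -
  have diag: "A $ i $ i = A $ j $ j" if "i \<noteq> j" for i j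
  proof -
    \<comment> \<open>The \<open>(i, j)\<close> entry of the commutator of \<open>A\<close> with the
      elementary matrix is \<open>A $ i $ i - A $ j $ j\<close>, and \<open>ker_offdiag\<close>
      makes it vanish.\<close>
    have "ker (lie_A A s t (mat_unit i j 1) 0 0) (lie_s A s t (mat_unit i j 1) 0 0) (lie_t A s t (mat_unit i j 1) 0 0)"
      using that by (intro ker_bracket assms) auto
    from ker_offdiag[OF this, of j i] that show ?thesis
      using exhaust_3[of i] exhaust_3[of j] by (auto simp: lie_A_def vec3_simps mat_unit_nth)
  qed
  have A: "A = 0"
  proof -
    have "trace A = 0" using assms by (simp add: ker_def)
    then have "A $ 1 $ 1 = 0" "A $ 2 $ 2 = 0" "A $ 3 $ 3 = 0"
      using diag[of 1 2] diag[of 1 3] by (simp_all add: trace_0_nth)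
    then show ?thesis
      using ker_offdiag[OF assms, of 1 2] ker_offdiag[OF assms, of 2 1] ker_offdiag[OF assms, of 1 3]
        ker_offdiag[OF assms, of 3 1] ker_offdiag[OF assms, of 2 3] ker_offdiag[OF assms, of 3 2]
      by (simp add: vec3_simps)
  qed
  have "t $ j = 0" if "i \<noteq> j" for i j
  proof -
    \<comment> \<open>Off the diagonal and with \<open>A = 0\<close>, this bracket has entry
      \<open>3 * t $ j\<close> at \<open>(i, j)\<close>; below, an element of V^* extracts
      \<open>s $ j\<close> in the same way.\<close>
    have "ker (lie_A A s t 0 (axis i 1) 0) (lie_s A s t 0 (axis i 1) 0) (lie_t A s t 0 (axis i 1) 0)"
      by (intro ker_bracket assms) simp
    from ker_offdiag[OF this, of j i] that show ?thesis
      by (auto simp: lie_A_def axis_def A)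
  qed
  from this[of 1 2] this[of 1 3] this[of 2 1] have t: "t = 0"
    by (simp add: vec3_simps)
  have "s $ j = 0" if "i \<noteq> j" for i j
  proof -
    have "ker (lie_A A s t 0 0 (axis i 1)) (lie_s A s t 0 0 (axis i 1)) (lie_t A s t 0 0 (axis i 1))"
      by (intro ker_bracket assms) simp
    from ker_offdiag[OF this, of i j] that show ?thesis
      by (auto simp: lie_A_def axis_def A)
  qed
  from this[of 1 2] this[of 1 3] this[of 2 1] have "s = 0"
    by (simp add: vec3_simps)
  with A t show ?thesis by simp
qed

lemma fld_eq_iff:
  assumes "trace A = 0" "trace A' = 0"
  shows "fld A s t = fld A' s' t' \<longleftrightarrow> A = A' \<and> s = s' \<and> t = t'"
proof
  assume eq: "fld A s t = fld A' s' t'"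
  let ?B = "mat_scale (- 1) A'"
  have B: "trace ?B = 0" "A + ?B = A - A'"
    using assms by (simp_all add: trace_mat_scale vec_eq_iff)
  have "fld (A + ?B) (s + (- 1) *s s') (t + (- 1) *s t') = fld A s t + vf_scale (- 1) (fld A' s' t')"
    by (simp add: fld_add fld_scale assms B)
  also have "\<dots> = 0"
    by (simp add: eq vf_scale_def fun_eq_iff)
  finally have "ker (A - A') (s + (- 1) *s s') (t + (- 1) *s t')"
    using assms by (simp add: ker_def B trace_sub)
  from ker_trivial[OF this] show "A = A' \<and> s = s' \<and> t = t'"
    by (simp add: add_eq_0_iff)
qed simp

end

section \<open>The Lie algebra of realized vector fields\<close>

text \<open>Coefficients are indexed by positions rather than by vectors, so that a single
  hypothesis yields both distinctness and independence.\<close>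

lemma (in vector_space) independent_list:
  assumes zero: "\<And>c i. (\<Sum>i<length bs. scale (c i) (bs ! i)) = 0 \<Longrightarrow> i < length bs \<Longrightarrow> c i = 0"
  shows "distinct bs" and "independent (set bs)"
proof -
  show dist: "distinct bs"
    unfolding distinct_conv_nth
  proof (intro allI impI notI)
    fix i j assume ij: "i < length bs" "j < length bs" "i \<noteq> j" "bs ! i = bs ! j"
    \<comment> \<open>A repeated entry would give the nontrivial relation with coefficients 1 at
      \<open>i\<close> and -1 at \<open>j\<close>.\<close>
    define c :: "nat \<Rightarrow> 'a" where "c k = (if k = i then 1 else 0) - (if k = j then 1 else 0)" for k
    have "(\<Sum>k<length bs. scale (c k) (bs ! k))
      = (\<Sum>k<length bs. if k = i then bs ! k else 0) - (\<Sum>k<length bs. if k = j then bs ! k else 0)"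
      unfolding sum_subtractf[symmetric] by (intro sum.cong) (auto simp: c_def)
    also have "\<dots> = 0" using ij by simp
    finally show False using zero[of c i] ij by (simp add: c_def)
  qed
  show "independent (set bs)"
  proof (rule independent_if_scalars_zero)
    fix f x assume sum0: "(\<Sum>x\<in>set bs. scale (f x) x) = 0" and "x \<in> set bs"
    then obtain i where i: "i < length bs" "x = bs ! i" by (auto simp: in_set_conv_nth)
    have "(\<Sum>i<length bs. scale (f (bs ! i)) (bs ! i)) = (\<Sum>x\<in>set bs. scale (f x) x)"
      using bij_betw_nth[OF dist refl refl] by (rule sum.reindex_bij_betw)
    with zero[of "\<lambda>i. f (bs ! i)" i] sum0 i show "f x = 0" by simp
  qed simp
qed

definition diag3 :: "'a::zero \<Rightarrow> 'a \<Rightarrow> 'a \<Rightarrow> 'a^3^3" where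
  "diag3 x y z = (\<chi> i j. if i = j then vector [x, y, z] $ i else 0)"

lemma diag3_nth: "diag3 x y z $ i $ j = (if i = j then vector [x, y, z] $ i else 0)"
  by (simp add: diag3_def)

lemma trace_diag3 [simp]: "trace (diag3 x y z) = x + y + z"
  by (simp add: trace_def sum_3 diag3_nth)

lemma split_g2_add: "D \<in> split_g2 \<Longrightarrow> E \<in> split_g2 \<Longrightarrow> D + E \<in> split_g2"
  for D E :: "'a::{field,ring_char_0} zorn \<Rightarrow> 'a zorn"
  unfolding split_g2_eq by (auto simp: der_plus trace_add) (metis trace_add add.left_neutral)

lemma split_g2_scale: "D \<in> split_g2 \<Longrightarrow> end_scale c D \<in> split_g2"
  for D :: "'a::{field,ring_char_0} zorn \<Rightarrow> 'a zorn"
  unfolding split_g2_eq by (auto simp: end_scale_der) (metis trace_mat_scale mult_zero_right)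

lemma split_g2_commutator: "D \<in> split_g2 \<Longrightarrow> E \<in> split_g2 \<Longrightarrow> commutator D E \<in> split_g2"
  for D E :: "'a::{field,ring_char_0} zorn \<Rightarrow> 'a zorn"
  unfolding split_g2_eq using commutator_der trace_lie_A by (smt (verit) mem_Collect_eq)

lemma split_g2_0: "(0 :: 'a::field zorn \<Rightarrow> 'a zorn) \<in> split_g2"
proof -
  have zero: "(0 :: 'a zorn \<Rightarrow> 'a zorn) = der 0 0 0"
    by (rule ext, rename_tac x, case_tac x) (simp add: vec3_simps zero_prod_def)
  show ?thesis by (subst zero, rule der_in_split_g2) simp
qed

lemma split_g2_apply_add: "D \<in> split_g2 \<Longrightarrow> D (x + y) = D x + D y"
  unfolding split_g2_def by blast

lemma split_g2_apply_diff: "D \<in> split_g2 \<Longrightarrow> D (x - y) = D x - D y"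
  using split_g2_apply_add[of D "x - y" y] by simp

lemma split_g2_apply_scale: "D \<in> split_g2 \<Longrightarrow> D (zorn_scale c x) = zorn_scale c (D x)"
  unfolding split_g2_def by blast

section \<open>Transport of the Lie structure from derivations to vector fields\<close>

context g2_chart
begin

text \<open>\<open>fld\<close> indexed by the derivation itself, so that identities between
  commutators can be transported without components.\<close>

definition fld_of :: "('a zorn \<Rightarrow> 'a zorn) \<Rightarrow> 'a vfield" where
  "fld_of D = (THE X. related U \<Psi> X D)"

lemma fld_of_der: "fld_of (der A s t) = fld A s t"
  by (simp add: fld_of_def fld_def)

lemma fld_of_add: "D \<in> split_g2 \<Longrightarrow> E \<in> split_g2 \<Longrightarrow> fld_of D + fld_of E = fld_of (D + E)"
  unfolding split_g2_eq by (auto simp: fld_of_der fld_add der_plus)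

lemma fld_of_scale: "D \<in> split_g2 \<Longrightarrow> vf_scale c (fld_of D) = fld_of (end_scale c D)"
  unfolding split_g2_eq by (auto simp: fld_of_der fld_scale end_scale_der)

lemma fld_of_bracket:
  "D \<in> split_g2 \<Longrightarrow> E \<in> split_g2 \<Longrightarrow> lie_bracket U (fld_of D) (fld_of E) = fld_of (commutator D E)"
  unfolding split_g2_eq by (auto simp: fld_of_der fld_bracket commutator_der)

lemma inj_on_fld_of: "inj_on fld_of split_g2"
  unfolding split_g2_eq by (auto simp: inj_on_def fld_of_der fld_eq_iff)

definition alg :: "'a vfield set" where
  "alg = fld_of ` split_g2"

lemma alg_eq: "alg = {fld A s t | A s t. trace A = 0}"
  unfolding alg_def split_g2_eq fld_of_der[symmetric] by blast

lemma fld_cong: "A = A' \<Longrightarrow> s = s' \<Longrightarrow> t = t' \<Longrightarrow> fld A s t = fld A' s' t'"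
  by simp

lemma fld_in_alg: "trace A = 0 \<Longrightarrow> fld A s t \<in> alg"
  unfolding alg_eq by blast

sublocale vf: vector_space vf_scale
  by (rule vector_space_vf_scale)

lemma subspace_alg: "vf.subspace alg"
  unfolding vf.subspace_def
proof (intro conjI ballI allI)
  show "0 \<in> alg" using fld_0 fld_in_alg[of 0 0 0] by simp
qed (auto simp: alg_def fld_of_add fld_of_scale split_g2_add split_g2_scale)

text \<open>Bilinearity and the Jacobi identity hold for commutators of linear maps and are carried
  over by \<open>fld_of\<close>; no further differentiation of vector fields is involved.\<close>

lemma lie_algebra_alg: "lie_algebra vf_scale alg (lie_bracket U)"
proof (intro lie_algebra.intro vector_space_vf_scale lie_algebra_axioms.intro subspace_alg)
  note simps = alg_def fld_of_add fld_of_scale fld_of_bracket split_g2_add split_g2_scale split_g2_commutator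
  note arg = arg_cong[where f = fld_of]
  note der_apply = split_g2_apply_add split_g2_apply_diff split_g2_apply_scale
  have zero: "fld_of 0 = 0"
    using fld_of_scale[OF split_g2_0, of 0] fld_of_add[OF split_g2_0 split_g2_0] by simp
  fix x y z :: "'a vfield" and c
  assume "x \<in> alg"
  then obtain D where D: "D \<in> split_g2" "x = fld_of D" by (auto simp: alg_def)
  show "lie_bracket U x x = 0"
    using D by (simp add: simps commutator_def zero flip: zero_fun_def)
  assume "y \<in> alg"
  then obtain E where E: "E \<in> split_g2" "y = fld_of E" by (auto simp: alg_def)
  show "lie_bracket U x y \<in> alg"
    using D E by (simp add: simps)
  show "lie_bracket U (vf_scale c x) y = vf_scale c (lie_bracket U x y)"
    "lie_bracket U x (vf_scale c y) = vf_scale c (lie_bracket U x y)"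
    using D E by (simp_all add: simps)
      (intro arg ext; simp add: commutator_def end_scale_def der_apply zorn_scale_simps)+
  assume "z \<in> alg"
  then obtain F where F: "F \<in> split_g2" "z = fld_of F" by (auto simp: alg_def)
  show "lie_bracket U (x + y) z = lie_bracket U x z + lie_bracket U y z"
    "lie_bracket U x (y + z) = lie_bracket U x y + lie_bracket U x z"
    using D E F by (simp_all add: simps) (intro arg ext; simp add: commutator_def der_apply)+
  have "commutator D (commutator E F) + commutator E (commutator F D) + commutator F (commutator D E) = 0"
    using D E F by (intro ext) (simp add: commutator_def der_apply)
  then show "lie_bracket U x (lie_bracket U y z) + lie_bracket U y (lie_bracket U z x)
      + lie_bracket U z (lie_bracket U x y) = 0"
    using D E F by (simp add: simps zero)
qed

lemma lie_isomorphic_alg: "lie_isomorphic vf_scale alg (lie_bracket U) end_scale split_g2 commutator"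
  unfolding lie_isomorphic_def
proof (intro exI conjI)
  let ?\<phi> = "inv_into split_g2 fld_of"
  have inv: "?\<phi> (fld_of D) = D" if "D \<in> split_g2" for D
    using inv_into_f_f[OF inj_on_fld_of that] .
  show "bij_betw ?\<phi> alg split_g2"
    unfolding alg_def by (rule bij_betw_inv_into) (simp add: bij_betw_def inj_on_fld_of)
  show "\<forall>x\<in>alg. \<forall>y\<in>alg. ?\<phi> (x + y) = ?\<phi> x + ?\<phi> y"
    "\<forall>c. \<forall>x\<in>alg. ?\<phi> (vf_scale c x) = end_scale c (?\<phi> x)"
    "\<forall>x\<in>alg. \<forall>y\<in>alg. ?\<phi> (lie_bracket U x y) = commutator (?\<phi> x) (?\<phi> y)"
    by (auto simp: alg_def fld_of_add fld_of_scale fld_of_bracket inv split_g2_add split_g2_scale split_g2_commutator)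
qed

lemma bracket_diag3:
  assumes "x + y + z = 0" "trace A = 0"
  shows "lie_bracket U (fld (diag3 x y z) 0 0) (fld A s t)
    = fld (\<chi> i j. (vector [x, y, z] $ i - vector [x, y, z] $ j) * A $ i $ j)
        (\<chi> i. vector [x, y, z] $ i * s $ i) (\<chi> i. - (vector [x, y, z] $ i * t $ i))"
proof -
  have "lie_A (diag3 x y z) 0 0 A s t = (\<chi> i j. (vector [x, y, z] $ i - vector [x, y, z] $ j) * A $ i $ j)"
    "lie_s (diag3 x y z) 0 0 A s t = (\<chi> i. vector [x, y, z] $ i * s $ i)"
    "lie_t (diag3 x y z) 0 0 A s t = (\<chi> i. - (vector [x, y, z] $ i * t $ i))"
    by (simp_all add: lie_A_def lie_s_def lie_t_def vec3_simps diag3_nth algebra_simps)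
  with assms show ?thesis by (simp add: fld_bracket)
qed

text \<open>Turns a root condition into a comparison of the diagonal entries with \<open>k\<close>
  on the support of \<open>A\<close>, \<open>s\<close> and \<open>t\<close>: the weights are
  differences of entries on sl_3, entries on V, and their negatives on V^*.\<close>

lemma bracket_diag3_eigen:
  assumes "x + y + z = 0" "trace A = 0"
    and "\<forall>i j. (vector [x, y, z] $ i - vector [x, y, z] $ j) * A $ i $ j = k * A $ i $ j"
    and "\<forall>i. vector [x, y, z] $ i * s $ i = k * s $ i"
    and "\<forall>i. - (vector [x, y, z] $ i * t $ i) = k * t $ i"
  shows "lie_bracket U (fld (diag3 x y z) 0 0) (fld A s t) = vf_scale k (fld A s t)"
  unfolding bracket_diag3[OF assms(1,2)] fld_scale[OF assms(2)] mat_scale_def vector_scalar_mult_def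
  by (simp only: assms(3-)[rule_format])

section \<open>The diagonal Cartan subalgebra\<close>

definition cartan :: "'a vfield set" where
  "cartan = {fld (diag3 x y (- x - y)) 0 0 | x y. True}"

lemma fld_diag3_in_cartan:
  assumes "x + y + z = 0"
  shows "fld (diag3 x y z) 0 0 \<in> cartan"
proof -
  have "z = - x - y"
    using assms by (simp add: eq_diff_eq eq_neg_iff_add_eq_0 ac_simps)
  then show ?thesis unfolding cartan_def by blast
qed

lemma cartan_subalgebra_cartan:
  assumes "vf.span B = cartan"
  shows "lie_algebra.cartan_subalgebra vf_scale alg (lie_bracket U) cartan"
proof -
  interpret lie_algebra vf_scale alg "lie_bracket U"
    by (rule lie_algebra_alg)
  have sub: "cartan \<subseteq> alg"
    by (auto simp: cartan_def intro: fld_in_alg)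
  have bracket_0: "lie_bracket U x y = 0" if "x \<in> cartan" "y \<in> cartan" for x y
  proof -
    have "(\<chi> i j. (vector [a, b, c] $ i - vector [a, b, c] $ j) * diag3 a' b' c' $ i $ j) = 0"
      for a b c a' b' c' :: 'a
      by (simp add: vec_eq_iff diag3_nth)
    with that show ?thesis
      by (auto simp: cartan_def bracket_diag3 zero_vec_def[symmetric] fld_0)
  qed
  have cartan: "vf.subspace cartan" "0 \<in> cartan"
    using vf.subspace_span[of B] vf.subspace_0[of cartan] assms by auto
  have "{lie_bracket U x y |x y. x \<in> cartan \<and> y \<in> cartan} = {0}"
    using bracket_0 cartan(2) by force
  then have "\<exists>n. lower_central_series cartan n = {0}"
    using vf.span_insert_0[of "{}"] by (intro exI[of _ 1]) simp
  moreover have "x \<in> cartan" if x_alg: "x \<in> alg" and norm: "\<forall>y\<in>cartan. lie_bracket U x y \<in> cartan" for x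
  proof -
    obtain A s t where x: "trace A = 0" "x = fld A s t"
      using x_alg unfolding alg_eq by blast
    \<comment> \<open>A regular element: the entries 1, 2, -3 are nonzero and pairwise distinct, so
      no root vanishes on it. If the bracket with it is diagonal, then the off-diagonal entries,
      \<open>s\<close> and \<open>t\<close> are all 0.\<close>
    define h where "h = fld (diag3 1 2 (- 3)) 0 0"
    have "h \<in> cartan"
      unfolding cartan_def h_def by (intro CollectI exI[of _ 1] exI[of _ 2]) simp
    with norm have "fld (lie_A A s t (diag3 1 2 (- 3)) 0 0) (lie_s A s t (diag3 1 2 (- 3)) 0 0)
        (lie_t A s t (diag3 1 2 (- 3)) 0 0) \<in> cartan"
      using fld_bracket[of A "diag3 1 2 (- 3)" s t 0 0] x trace_diag3[of 1 2 "- 3 :: 'a"]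
      by (simp add: h_def) metis
    then obtain a b where "lie_A A s t (diag3 1 2 (- 3)) 0 0 = diag3 a b (- a - b)"
      "lie_s A s t (diag3 1 2 (- 3)) 0 0 = 0" "lie_t A s t (diag3 1 2 (- 3)) 0 0 = 0"
      by (auto simp: cartan_def fld_eq_iff trace_lie_A)
    then have diag: "A = diag3 (A $ 1 $ 1) (A $ 2 $ 2) (- A $ 1 $ 1 - A $ 2 $ 2)" and "s = 0" "t = 0"
      using x(1) unfolding trace_0_nth
      by (auto simp: lie_A_def lie_s_def lie_t_def vec3_simps diag3_nth algebra_simps)
    then have "x = fld (diag3 (A $ 1 $ 1) (A $ 2 $ 2) (- A $ 1 $ 1 - A $ 2 $ 2)) 0 0"
      using arg_cong[OF diag, of "\<lambda>A. fld A 0 0"] x(2) by simp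
    then show ?thesis
      unfolding cartan_def by blast
  qed
  ultimately show ?thesis
    unfolding cartan_subalgebra_def using sub bracket_0 cartan by auto
qed

lemma fld_diff:
  "trace A = 0 \<Longrightarrow> trace A' = 0 \<Longrightarrow> fld A s t - fld A' s' t' = fld (A - A') (s - s') (t - t')"
  using fld_add[of "A - A'" A' "s - s'" "t - t'" s' t'] by (simp add: trace_sub algebra_simps)

lemma fld_eq_0_iff: "trace A = 0 \<Longrightarrow> fld A s t = 0 \<longleftrightarrow> A = 0 \<and> s = 0 \<and> t = 0"
  using fld_eq_iff[of A 0 s t 0 0] by (simp add: fld_0)

text \<open>The scalars enter \<open>H\<close> and \<open>h\<close> only through their product, and
  \<open>a * b * c = - 1\<close> gives \<open>h1\<close> and \<open>h2\<close> the diagonal entries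
  \<open>(-1/2, 1, -1/2)\<close> and \<open>sqrt 3 / 2\<close> times \<open>(-1, 0, 1)\<close>. The
  roots are the values of these on the weights of the triples.\<close>

lemma pairwise_bracket_generates:
  assumes abc: "a * b * c = - 1"
  shows "pairwise_bracket_generates_split_g2 U
    (fld 0 (axis 2 a) 0) (fld 0 (axis 3 b) 0) (fld 0 (axis 1 c) 0)"
proof -
  have nz: "a \<noteq> 0" "b \<noteq> 0" "c \<noteq> 0" using abc by auto
  have abc': "a * (b * (c * x)) = - x" for x
    using abc by (metis mult.assoc mult_minus1)
  let ?r3 = "of_real (sqrt 3) :: 'a"
  have r3: "?r3 * ?r3 = 3" "?r3 \<noteq> 0"
    by (simp_all flip: of_real_mult)
  define S1 where "S1 = fld 0 (axis 2 a) 0"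
  define S2 where "S2 = fld 0 (axis 3 b) 0"
  define S3 where "S3 = fld 0 (axis 1 c) 0"
  note comp = lie_A_def lie_s_def lie_t_def vec3_simps axis_def mat_unit_nth diag3_nth
  have S4: "lie_bracket U S1 S2 = fld 0 0 (axis 1 (2 * a * b))"
    and S5: "lie_bracket U S2 S3 = fld 0 0 (axis 2 (2 * b * c))"
    and S6: "lie_bracket U S3 S1 = fld 0 0 (axis 3 (2 * c * a))"
    by (simp_all add: S1_def S2_def S3_def fld_bracket fld_eq_iff trace_lie_A) (simp_all add: comp)
  have L1: "lie_bracket U S1 (fld 0 0 (axis 1 (2 * a * b))) = fld (mat_unit 2 1 (- 6 * a * a * b)) 0 0"
    and L2: "lie_bracket U S2 (fld 0 0 (axis 1 (2 * a * b))) = fld (mat_unit 3 1 (- 6 * a * b * b)) 0 0"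
    and L3: "lie_bracket U S2 (fld 0 0 (axis 2 (2 * b * c))) = fld (mat_unit 3 2 (- 6 * b * b * c)) 0 0"
    and L4: "lie_bracket U S3 (fld 0 0 (axis 2 (2 * b * c))) = fld (mat_unit 1 2 (- 6 * b * c * c)) 0 0"
    and L5: "lie_bracket U S3 (fld 0 0 (axis 3 (2 * c * a))) = fld (mat_unit 1 3 (- 6 * c * c * a)) 0 0"
    and L6: "lie_bracket U S1 (fld 0 0 (axis 3 (2 * c * a))) = fld (mat_unit 2 3 (- 6 * c * a * a)) 0 0"
    by (simp_all add: S1_def S2_def S3_def fld_bracket fld_eq_iff trace_lie_A) (simp_all add: comp)
  \<comment> \<open>Before the product is inserted, the diagonals are \<open>a * b * c\<close> times
    \<open>(2, 2, -4)\<close> and \<open>(4, -2, -2)\<close>.\<close>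
  have H: "lie_bracket U S2 (fld 0 0 (axis 3 (2 * c * a))) = fld (diag3 (- 2) (- 2) 4) 0 0"
    and h: "lie_bracket U (fld 0 0 (axis 1 (2 * a * b))) S3 = fld (diag3 (- 4) 2 2) 0 0"
    by (simp_all add: S2_def S3_def fld_bracket fld_eq_iff trace_lie_A) (simp_all add: comp mult_ac abc')
  define h1 where "h1 = fld (diag3 (- 1/2) 1 (- 1/2)) 0 0"
  define h2 where "h2 = fld (diag3 (- ?r3/2) 0 (?r3/2)) 0 0"
  have h1: "vf_scale (1/4) (fld (diag3 (- 4) 2 2) 0 0 - fld (diag3 (- 2) (- 2) 4) 0 0) = h1"
    and h2: "vf_scale (?r3/12) (fld (diag3 (- 4) 2 2) 0 0 + fld (diag3 (- 2) (- 2) 4) 0 0) = h2"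
    by (simp_all add: h1_def h2_def fld_scale fld_add fld_diff fld_eq_iff trace_add trace_sub trace_mat_scale)
      (simp_all add: comp)
  let ?basis = "[S1, S2, S3, fld 0 0 (axis 1 (2 * a * b)), fld 0 0 (axis 2 (2 * b * c)),
    fld 0 0 (axis 3 (2 * c * a)), h1, h2, fld (mat_unit 2 1 (- 6 * a * a * b)) 0 0,
    fld (mat_unit 3 1 (- 6 * a * b * b)) 0 0, fld (mat_unit 3 2 (- 6 * b * b * c)) 0 0,
    fld (mat_unit 1 2 (- 6 * b * c * c)) 0 0, fld (mat_unit 1 3 (- 6 * c * c * a)) 0 0,
    fld (mat_unit 2 3 (- 6 * c * a * a)) 0 0]"
  note combine = S1_def S2_def S3_def h1_def h2_def fld_scale fld_add trace_add trace_mat_scale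
  \<comment> \<open>The general combination as one triple. Independence reads off its entries; the
    spanning property solves for them.\<close>
  have comb: "vf_scale k1 S1 + vf_scale k2 S2 + vf_scale k3 S3
      + vf_scale k4 (fld 0 0 (axis 1 (2 * a * b))) + vf_scale k5 (fld 0 0 (axis 2 (2 * b * c)))
      + vf_scale k6 (fld 0 0 (axis 3 (2 * c * a))) + vf_scale k7 h1 + vf_scale k8 h2
      + vf_scale k9 (fld (mat_unit 2 1 (- 6 * a * a * b)) 0 0)
      + vf_scale k10 (fld (mat_unit 3 1 (- 6 * a * b * b)) 0 0)
      + vf_scale k11 (fld (mat_unit 3 2 (- 6 * b * b * c)) 0 0)
      + vf_scale k12 (fld (mat_unit 1 2 (- 6 * b * c * c)) 0 0)
      + vf_scale k13 (fld (mat_unit 1 3 (- 6 * c * c * a)) 0 0)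
      + vf_scale k14 (fld (mat_unit 2 3 (- 6 * c * a * a)) 0 0)
    = fld (vector [vector [- k7 / 2 - k8 * ?r3 / 2, - 6 * b * c * c * k12, - 6 * c * c * a * k13],
                   vector [- 6 * a * a * b * k9, k7, - 6 * c * a * a * k14],
                   vector [- 6 * a * b * b * k10, - 6 * b * b * c * k11, - k7 / 2 + k8 * ?r3 / 2]])
          (vector [c * k3, a * k1, b * k2])
          (vector [2 * a * b * k4, 2 * b * c * k5, 2 * c * a * k6])"
    (is "_ = fld ?M _ _") for k1 k2 k3 k4 k5 k6 k7 k8 k9 k10 k11 k12 k13 k14
  proof -
    have "trace ?M = 0" by (simp add: trace_def sum_3)
    then show ?thesis
      by (simp add: combine fld_eq_iff) (simp add: comp mult_ac)
  qed
  have indep: "distinct ?basis \<and> vf.independent (set ?basis)"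
  proof -
    have "\<forall>i<length ?basis. k i = 0" if "(\<Sum>i<length ?basis. vf_scale (k i) (?basis ! i)) = 0" for k
    proof -
      have "(\<Sum>i<length ?basis. vf_scale (k i) (?basis ! i))
        = fld (vector [vector [- k 6 / 2 - k 7 * ?r3 / 2, - 6 * b * c * c * k 11, - 6 * c * c * a * k 12],
                   vector [- 6 * a * a * b * k 8, k 6, - 6 * c * a * a * k 13],
                   vector [- 6 * a * b * b * k 9, - 6 * b * b * c * k 10, - k 6 / 2 + k 7 * ?r3 / 2]])
          (vector [c * k 2, a * k 0, b * k 1])
          (vector [2 * a * b * k 3, 2 * b * c * k 4, 2 * c * a * k 5])"
        unfolding comb[symmetric] by (simp add: numeral_eq_Suc)
      \<comment> \<open>The bound 14 is spelled in successor form so that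
        \<open>All_less_Suc\<close> splits it into single equations.\<close>
      with that have "\<forall>i<Suc (Suc (Suc (Suc (Suc (Suc (Suc (Suc (Suc (Suc (Suc (Suc (Suc (Suc 0))))))))))))). k i = 0"
        using nz r3(2) by (simp add: fld_eq_0_iff trace_def sum_3) (auto simp: vec3_simps All_less_Suc numeral_eq_Suc)
      then show ?thesis by simp
    qed
    then show ?thesis
      using vf.independent_list[of ?basis] by blast
  qed
  have span: "vf.span (set ?basis) = alg"
  proof
    show "vf.span (set ?basis) \<subseteq> alg"
      by (rule vf.span_minimal[OF _ subspace_alg])
        (simp add: S1_def S2_def S3_def h1_def h2_def fld_in_alg)
    show "alg \<subseteq> vf.span (set ?basis)"
    proof
      fix X assume "X \<in> alg"
      then obtain A s t where X: "X = fld A s t" "trace A = 0"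
        unfolding alg_eq by blast
      \<comment> \<open>All coefficients are quotients of matching entries, except on the diagonal:
        the \<open>(2, 2)\<close> entry gives the coefficient of \<open>h1\<close>, the
        \<open>(1, 1)\<close> entry then that of \<open>h2\<close>, and the trace condition accounts
        for the third entry.\<close>
      have "X = vf_scale (s $ 2 / a) S1 + vf_scale (s $ 3 / b) S2 + vf_scale (s $ 1 / c) S3
        + vf_scale (t $ 1 / (2 * a * b)) (fld 0 0 (axis 1 (2 * a * b)))
        + vf_scale (t $ 2 / (2 * b * c)) (fld 0 0 (axis 2 (2 * b * c)))
        + vf_scale (t $ 3 / (2 * c * a)) (fld 0 0 (axis 3 (2 * c * a)))
        + vf_scale (A $ 2 $ 2) h1 + vf_scale (- (2 * A $ 1 $ 1 + A $ 2 $ 2) / ?r3) h2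
        + vf_scale (A $ 2 $ 1 / (- 6 * a * a * b)) (fld (mat_unit 2 1 (- 6 * a * a * b)) 0 0)
        + vf_scale (A $ 3 $ 1 / (- 6 * a * b * b)) (fld (mat_unit 3 1 (- 6 * a * b * b)) 0 0)
        + vf_scale (A $ 3 $ 2 / (- 6 * b * b * c)) (fld (mat_unit 3 2 (- 6 * b * b * c)) 0 0)
        + vf_scale (A $ 1 $ 2 / (- 6 * b * c * c)) (fld (mat_unit 1 2 (- 6 * b * c * c)) 0 0)
        + vf_scale (A $ 1 $ 3 / (- 6 * c * c * a)) (fld (mat_unit 1 3 (- 6 * c * c * a)) 0 0)
        + vf_scale (A $ 2 $ 3 / (- 6 * c * a * a)) (fld (mat_unit 2 3 (- 6 * c * a * a)) 0 0)"
        unfolding comb X(1) using nz r3(2)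
        by (intro fld_cong; simp add: vec3_simps X(2)[unfolded trace_0_nth]; simp add: field_simps)
      also have "\<dots> \<in> vf.span (set ?basis)"
        by (intro vf.span_add vf.span_scale vf.span_base) simp_all
      finally show "X \<in> vf.span (set ?basis)" .
    qed
  qed
  have span_h: "vf.span {h1, h2} = cartan"
  proof
    have add: "diag3 x y (- x - y) + diag3 x' y' (- x' - y') = diag3 (x + x') (y + y') (- (x + x') - (y + y'))"
      and scale: "mat_scale k (diag3 x y (- x - y)) = diag3 (k * x) (k * y) (- (k * x) - k * y)"
      for x y x' y' k :: 'a
      by (simp_all add: comp algebra_simps)
    have zero: "diag3 0 0 (- 0 - 0) = (0 :: 'a^3^3)"
      by (simp add: comp)
    have "vf.subspace cartan"
      unfolding vf.subspace_def
    proof (intro conjI ballI allI)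
      show "0 \<in> cartan"
        using fld_diag3_in_cartan[of 0 0 0] zero fld_0 by simp
      fix X Y k
      assume "X \<in> cartan"
      then obtain x y where X: "X = fld (diag3 x y (- x - y)) 0 0"
        unfolding cartan_def by blast
      then show "vf_scale k X \<in> cartan"
        by (simp add: fld_scale scale fld_diag3_in_cartan)
      assume "Y \<in> cartan"
      then obtain x' y' where "Y = fld (diag3 x' y' (- x' - y')) 0 0"
        unfolding cartan_def by blast
      with X show "X + Y \<in> cartan"
        by (simp add: fld_add add fld_diag3_in_cartan)
    qed
    moreover have "h1 \<in> cartan" "h2 \<in> cartan"
      unfolding h1_def h2_def by (rule fld_diag3_in_cartan, simp)+
    ultimately show "vf.span {h1, h2} \<subseteq> cartan"
      by (intro vf.span_minimal) auto
    show "cartan \<subseteq> vf.span {h1, h2}"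
    proof
      fix X assume "X \<in> cartan"
      then obtain x y where "X = fld (diag3 x y (- x - y)) 0 0"
        unfolding cartan_def by blast
      then have "X = vf_scale y h1 + vf_scale (- (2 * x + y) / ?r3) h2"
        using r3(2) by (simp add: combine fld_eq_iff) (simp add: comp, simp add: field_simps)
      also have "\<dots> \<in> vf.span {h1, h2}"
        by (intro vf.span_add vf.span_scale vf.span_base) simp_all
      finally show "X \<in> vf.span {h1, h2}" .
    qed
  qed
  note generated = S4 S5 S6 L1 L2 L3 L4 L5 L6 H h h1 h2 span span_h
  show ?thesis
    unfolding pairwise_bracket_generates_split_g2_def Let_def S1_def[symmetric] S2_def[symmetric] S3_def[symmetric]
      generated
    by (intro conjI conjunct1[OF indep] conjunct2[OF indep] lie_algebra_alg lie_isomorphic_alg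
        cartan_subalgebra_cartan[OF span_h]; unfold S1_def S2_def S3_def h1_def h2_def;
        rule bracket_diag3_eigen; simp add: forall_3 mat_unit_nth axis_def)
qed

end

section \<open>Flat coordinates\<close>

lemma has_derivative_vector_3:
  assumes "(f has_derivative f') F" "(g has_derivative g') F" "(h has_derivative h') F"
  shows "((\<lambda>x. vector [f x, g x, h x] :: 'a::real_normed_vector^3) has_derivative
    (\<lambda>v. vector [f' v, g' v, h' v])) F"
proof (rule has_derivative_vecI)
  show "((\<lambda>x. (vector [f x, g x, h x] :: 'a^3) $ i) has_derivative
      (\<lambda>v. (vector [f' v, g' v, h' v] :: 'a^3) $ i)) F" for i
    using exhaust_3[of i] assms by auto
qed

lemma exhaust_5:
  fixes i :: 5
  shows "i = 1 \<or> i = 2 \<or> i = 3 \<or> i = 4 \<or> i = 5"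
proof (induct i)
  case (of_int z)
  then have "0 \<le> z" and "z < 5" by simp_all
  then have "z = 0 \<or> z = 1 \<or> z = 2 \<or> z = 3 \<or> z = 4" by arith
  then show ?case by auto
qed

lemma forall_5: "(\<forall>i::5. P i) \<longleftrightarrow> P 1 \<and> P 2 \<and> P 3 \<and> P 4 \<and> P 5"
  by (metis exhaust_5)

locale monge_domain =
  fixes \<alpha> \<beta> g3 \<delta> :: "'a::real_normed_field" and U :: "('a^5) set"
  assumes \<delta>: "\<delta> \<noteq> 0" and open_U: "open U" and U_ne: "U \<noteq> {}"
    and Y_ne: "x \<in> U \<Longrightarrow> Yf \<alpha> \<beta> g3 x \<noteq> 0" and G_ne: "x \<in> U \<Longrightarrow> Gf g3 x \<noteq> 0"
begin

abbreviation Y :: "'a^5 \<Rightarrow> 'a" where "Y \<equiv> Yf \<alpha> \<beta> g3"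
abbreviation G :: "'a^5 \<Rightarrow> 'a" where "G \<equiv> Gf g3"

text \<open>
  \<open>Y'\<close> is the \<open>w\<close>-derivative of \<open>Y\<close>. Along the integral curves of \<open>X2\<close>, one has \<open>dr/dw = 2n\<close>
  and \<open>dn/dw = 2e\<close>. In the coordinates \<open>(w, r, n, e, Q)\<close> the fields \<open>S1\<close>, \<open>S2\<close>, \<open>S3\<close> are
  polynomial.
\<close>

definition Y' :: "'a^5 \<Rightarrow> 'a" where "Y' x = \<alpha> + 3 * \<beta> * (x $ 1)^2"
definition r :: "'a^5 \<Rightarrow> 'a" where "r x = Y x * x $ 2"
definition n :: "'a^5 \<Rightarrow> 'a" where "n x = Y' x * x $ 2 / 2 + G x * x $ 4 / Y x"
definition e :: "'a^5 \<Rightarrow> 'a" where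
  "e x = (G x)^2 * x $ 5 / (Y x)^3 + 6 * (x $ 1)^2 * x $ 4 / Y x + 3/2 * \<beta> * x $ 1 * x $ 2"
text \<open>The part of \<open>e\<close> free of \<open>q\<close>, divided by \<open>3 * w\<close>.
  With \<open>R = G^2 * q / Y^3\<close> one has \<open>e = R + 3 * w * k\<close>, and
  \<open>dk/dw = 4 * w * R / G\<close> along \<open>X2\<close>.\<close>

definition k :: "'a^5 \<Rightarrow> 'a" where "k x = 2 * x $ 1 * x $ 4 / Y x + \<beta> * x $ 2 / 2"
text \<open>\<open>6 * z\<close> completed to a first integral of \<open>S1\<close>. With
  \<open>w\<close> as parameter along \<open>S1\<close>, \<open>z\<close> has derivative
  \<open>2 * R^2\<close>, \<open>e\<close> is constant, and \<open>n\<close> and \<open>k\<close>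
  have derivatives \<open>2 * e\<close> and \<open>4 * w * R / G\<close>, where
  \<open>R = e - 3 * w * k\<close>. The derivative of \<open>Q\<close> is therefore
  \<open>12 * R^2 + 108 * w^2 * k^2 + 72 * w * k * R - 12 * e^2 = 0\<close>.\<close>

definition Q :: "'a^5 \<Rightarrow> 'a" where
  "Q x = 6 * x $ 3 + 9 * G x * (k x)^2 - 8 * n x * e x + 4 * x $ 1 * (e x)^2"

text \<open>The first entry of the third component makes the square of \<open>psi x\<close> vanish.\<close>

definition psi :: "'a^5 \<Rightarrow> 'a zorn" where
  "psi x = (- 2 * (n x - x $ 1 * e x),
     vector [1, 2 * x $ 1 * n x - 3 * r x, Q x],
     vector [x $ 1 * Q x - 4 * (n x - x $ 1 * e x)^2 - 2 * e x * (2 * x $ 1 * n x - 3 * r x), 2 * e x, - x $ 1],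
     2 * (n x - x $ 1 * e x))"

lemma regular_YG: "regular U Y" "regular U G" "regular U Y'"
  unfolding Yf_def Gf_def Y'_def Let_def by (intro regular_intros)+

lemma regular_coords: "regular U r" "regular U n" "regular U e" "regular U k" "regular U Q"
proof -
  show reg: "regular U r" "regular U n" "regular U e" "regular U k"
    unfolding r_def n_def e_def k_def
    by (intro regular_intros regular_YG; simp add: Y_ne)+
  show "regular U Q"
    unfolding Q_def by (intro regular_intros regular_YG reg)
qed

lemma regular_zorn_psi: "regular_zorn U psi"
proof -
  have vec: "regular U (\<lambda>x. vector [f x, g x, h x] $ i)"
    if "regular U f" "regular U g" "regular U h" for f g h and i :: 3
    using exhaust_3[of i] that by auto
  show ?thesis
    unfolding regular_zorn_def zproj_def psi_def
    by (auto intro!: vec regular_intros regular_coords regular_minus)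
qed

section \<open>Differentials of the flat coordinates and of the immersion\<close>

lemma has_derivative_coord: "((\<lambda>x. x $ i) has_derivative (\<lambda>v. v $ i)) (at (x :: 'a^5))"
  by (rule bounded_linear_imp_has_derivative[OF bounded_linear_vec_nth])

lemma has_derivative_YG:
  "(Y has_derivative (\<lambda>v. Y' x * v $ 1)) (at x)"
  "(G has_derivative (\<lambda>v. 12 * (x $ 1)^2 * v $ 1)) (at x)"
  "(Y' has_derivative (\<lambda>v. 6 * \<beta> * x $ 1 * v $ 1)) (at x)"
  unfolding Yf_def[abs_def] Gf_def[abs_def] Y'_def[abs_def] Let_def
  by (auto intro!: derivative_eq_intros has_derivative_coord simp: fun_eq_iff power2_eq_square algebra_simps)

lemma has_derivative_r: "(r has_derivative (\<lambda>v. Y' x * v $ 1 * x $ 2 + Y x * v $ 2)) (at x)"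
  unfolding r_def[abs_def]
  by (auto intro!: derivative_eq_intros has_derivative_YG has_derivative_coord simp: fun_eq_iff algebra_simps)

lemma has_derivative_n:
  "x \<in> U \<Longrightarrow> (n has_derivative (\<lambda>v. 3 * \<beta> * x $ 1 * v $ 1 * x $ 2 + Y' x * v $ 2 / 2
     + (12 * (x $ 1)^2 * v $ 1 * x $ 4 + G x * v $ 4) / Y x - G x * x $ 4 * Y' x * v $ 1 / (Y x)^2)) (at x)"
  unfolding n_def[abs_def] using Y_ne[of x]
  by (auto intro!: derivative_eq_intros has_derivative_YG has_derivative_coord
      simp: fun_eq_iff field_simps power2_eq_square)

lemma has_derivative_e:
  "x \<in> U \<Longrightarrow> (e has_derivative (\<lambda>v. (24 * G x * (x $ 1)^2 * v $ 1 * x $ 5 + (G x)^2 * v $ 5) / (Y x)^3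
     - 3 * (G x)^2 * x $ 5 * Y' x * v $ 1 / (Y x)^4
     + (12 * x $ 1 * v $ 1 * x $ 4 + 6 * (x $ 1)^2 * v $ 4) / Y x - 6 * (x $ 1)^2 * x $ 4 * Y' x * v $ 1 / (Y x)^2
     + 3/2 * \<beta> * (v $ 1 * x $ 2 + x $ 1 * v $ 2))) (at x)"
  unfolding e_def[abs_def] using Y_ne[of x]
  by (auto intro!: derivative_eq_intros has_derivative_YG has_derivative_coord
      simp: fun_eq_iff field_simps power2_eq_square power3_eq_cube power4_eq_xxxx)

lemma has_derivative_k:
  "x \<in> U \<Longrightarrow> (k has_derivative (\<lambda>v. 2 * (v $ 1 * x $ 4 + x $ 1 * v $ 4) / Y x
     - 2 * x $ 1 * x $ 4 * Y' x * v $ 1 / (Y x)^2 + \<beta> * v $ 2 / 2)) (at x)"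
  unfolding k_def[abs_def] using Y_ne[of x]
  by (auto intro!: derivative_eq_intros has_derivative_YG has_derivative_coord
      simp: fun_eq_iff field_simps power2_eq_square)

abbreviation dd :: "('a^5 \<Rightarrow> 'a) \<Rightarrow> 'a^5 \<Rightarrow> 'a^5 \<Rightarrow> 'a" where
  "dd f x v \<equiv> frechet_derivative f (at x) v"

lemma has_derivative_dd: "x \<in> U \<Longrightarrow> regular U f \<Longrightarrow> (f has_derivative dd f x) (at x)"
  using regular_differentiable[OF open_U] frechet_derivative_works by blast

lemmas dd_r = frechet_derivative_eqI[OF has_derivative_r]
lemmas dd_n = frechet_derivative_eqI[OF has_derivative_n]
lemmas dd_e = frechet_derivative_eqI[OF has_derivative_e]
lemmas dd_k = frechet_derivative_eqI[OF has_derivative_k]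

lemma dd_Q:
  assumes "x \<in> U"
  shows "dd Q x v = 6 * v $ 3 + 9 * (12 * (x $ 1)^2 * v $ 1 * (k x)^2 + 2 * G x * k x * dd k x v)
    - 8 * (dd n x v * e x + n x * dd e x v) + 4 * (v $ 1 * (e x)^2 + 2 * x $ 1 * e x * dd e x v)"
proof -
  note d = has_derivative_dd[OF assms regular_coords(2)] has_derivative_dd[OF assms regular_coords(3)]
    has_derivative_dd[OF assms regular_coords(4)]
  have "(Q has_derivative (\<lambda>v. 6 * v $ 3 + 9 * (12 * (x $ 1)^2 * v $ 1 * (k x)^2 + 2 * G x * k x * dd k x v)
    - 8 * (dd n x v * e x + n x * dd e x v) + 4 * (v $ 1 * (e x)^2 + 2 * x $ 1 * e x * dd e x v))) (at x)"
    unfolding Q_def[abs_def]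
    by (auto intro!: derivative_eq_intros d has_derivative_YG has_derivative_coord simp: fun_eq_iff algebra_simps)
  then show ?thesis by (simp add: frechet_derivative_eqI)
qed

lemma dd_psi:
  assumes "x \<in> U"
  shows "frechet_derivative psi (at x) v =
    (- 2 * (dd n x v - v $ 1 * e x - x $ 1 * dd e x v),
     vector [0, 2 * (v $ 1 * n x + x $ 1 * dd n x v) - 3 * dd r x v, dd Q x v],
     vector [v $ 1 * Q x + x $ 1 * dd Q x v
         - 8 * (n x - x $ 1 * e x) * (dd n x v - v $ 1 * e x - x $ 1 * dd e x v)
         - 2 * dd e x v * (2 * x $ 1 * n x - 3 * r x)
         - 2 * e x * (2 * (v $ 1 * n x + x $ 1 * dd n x v) - 3 * dd r x v),
       2 * dd e x v, - v $ 1],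
     2 * (dd n x v - v $ 1 * e x - x $ 1 * dd e x v))"
proof -
  note d = has_derivative_dd[OF assms regular_coords(1)] has_derivative_dd[OF assms regular_coords(2)]
    has_derivative_dd[OF assms regular_coords(3)] has_derivative_dd[OF assms regular_coords(5)]
  have "(psi has_derivative (\<lambda>v.
    (- 2 * (dd n x v - v $ 1 * e x - x $ 1 * dd e x v),
     vector [0, 2 * (v $ 1 * n x + x $ 1 * dd n x v) - 3 * dd r x v, dd Q x v],
     vector [v $ 1 * Q x + x $ 1 * dd Q x v
         - 8 * (n x - x $ 1 * e x) * (dd n x v - v $ 1 * e x - x $ 1 * dd e x v)
         - 2 * dd e x v * (2 * x $ 1 * n x - 3 * r x)
         - 2 * e x * (2 * (v $ 1 * n x + x $ 1 * dd n x v) - 3 * dd r x v),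
       2 * dd e x v, - v $ 1],
     2 * (dd n x v - v $ 1 * e x - x $ 1 * dd e x v)))) (at x)"
    unfolding psi_def[abs_def]
    by (intro has_derivative_Pair has_derivative_vector_3;
        (rule derivative_eq_intros d has_derivative_coord refl)+; simp add: fun_eq_iff algebra_simps)
  then show ?thesis by (simp add: frechet_derivative_eqI)
qed

text \<open>The entries of the derivative yield the differentials of \<open>w\<close>,
  \<open>e\<close>, \<open>n\<close>, \<open>r\<close> and \<open>Q\<close>. This system is
  triangular in the original coordinates: \<open>r\<close> brings in \<open>y\<close> with factor
  \<open>Y\<close>, \<open>n\<close> brings in \<open>p\<close> with \<open>G / Y\<close>,
  \<open>e\<close> brings in \<open>q\<close> with \<open>G^2 / Y^3\<close>, and \<open>Q\<close>
  brings in \<open>z\<close> with 6.\<close>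

lemma psi_immersion:
  assumes x: "x \<in> U" and "frechet_derivative psi (at x) v = 0"
  shows "v = 0"
proof -
  from assms(2) have v1: "v $ 1 = 0" and de: "dd e x v = 0" and "dd n x v = 0" and "dd r x v = 0"
    and dQ: "dd Q x v = 0"
    unfolding dd_psi[OF x] by (auto simp: zero_prod_def vec_eq_iff forall_3)
  then have v2: "v $ 2 = 0" and v4: "v $ 4 = 0"
    using Y_ne[OF x] G_ne[OF x] by (auto simp: dd_r dd_n x)
  moreover have "v $ 5 = 0"
    using de v1 v2 v4 Y_ne[OF x] G_ne[OF x] by (simp add: dd_e x)
  moreover have "v $ 3 = 0"
    using dQ de \<open>dd n x v = 0\<close> v1 v2 v4 by (simp add: dd_Q x dd_k)
  ultimately show ?thesis
    using v1 by (simp add: vec_eq_iff forall_5)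
qed

end

section \<open>The three generators in flat coordinates\<close>

context monge_domain
begin

text \<open>The polynomials in \<open>\<alpha>\<close>, \<open>\<beta>\<close> and \<open>g3\<close>
  occurring in \<open>S1\<close> and \<open>Z1\<close>, expressed through \<open>w\<close>,
  \<open>Y\<close>, \<open>Y'\<close> and \<open>G\<close>. The first relation is behind the
  vanishing of the derivative of \<open>e\<close> along both fields.\<close>

lemma Y_relations:
  "Y x - x $ 1 * Y' x = - \<beta> * G x / 2"
  "\<alpha> * (8 * (x $ 1)^3 + g3) + 9 * \<beta> * g3 * (x $ 1)^2 = 12 * (x $ 1)^2 * Y x - G x * Y' x"
  "\<beta> * (8 * (x $ 1)^3 + g3) + 4 * \<alpha> * x $ 1 = 2 * (Y x + x $ 1 * Y' x)"
  by (simp_all add: Yf_def Gf_def Y'_def Let_def field_simps power2_eq_square power3_eq_cube)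

definition coord_derivs :: "('a^5) \<Rightarrow> ('a^5) \<Rightarrow> 'a \<times> 'a \<times> 'a \<times> 'a \<times> 'a" where
  "coord_derivs x v = (v $ 1, dd r x v, dd n x v, dd e x v, dd Q x v)"

lemma e_minus_k: "(G x)^2 * x $ 5 / (Y x)^3 = e x - 3 * x $ 1 * k x" if "x \<in> U"
  using Y_ne[OF that] unfolding e_def k_def by (simp add: field_simps power2_eq_square power3_eq_cube)

text \<open>Up to the factor \<open>- 4 * \<delta>^2\<close> this is the polynomial flow
  \<open>w' = 1\<close>, \<open>r' = 2 * n\<close>, \<open>n' = 2 * e\<close>, with \<open>e\<close>
  and \<open>Q\<close> constant; the \<open>X1\<close>-coefficient of \<open>S1\<close> is what
  keeps \<open>e\<close> constant.\<close>

lemma coord_derivs_S1: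
  assumes "x \<in> U"
  shows "coord_derivs x (S1 \<alpha> \<beta> g3 \<delta> x)
    = (- 4 * \<delta>^2, - 8 * \<delta>^2 * n x, - 8 * \<delta>^2 * e x, 0, 0)"
proof -
  note ne = Y_ne[OF assms] G_ne[OF assms]
  let ?w = "x $ 1" and ?y = "x $ 2" and ?p = "x $ 4" and ?q = "x $ 5"
  have v: "S1 \<alpha> \<beta> g3 \<delta> x $ 1 = - 4 * \<delta>^2"
    "S1 \<alpha> \<beta> g3 \<delta> x $ 2 = - 8 * \<delta>^2 * G x * ?p / (Y x)^2"
    "S1 \<alpha> \<beta> g3 \<delta> x $ 3 = - 8 * \<delta>^2 * (G x)^4 * ?q^2 / (Y x)^6"
    "S1 \<alpha> \<beta> g3 \<delta> x $ 4 = - 8 * \<delta>^2 * G x * ?q / (Y x)^2"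
    "S1 \<alpha> \<beta> g3 \<delta> x $ 5 = 6 * \<beta> * \<delta>^2 * (Y x)^3 / (G x)^2 * ?y + 24 * \<delta>^2 * ?w * (Y x)^2 / (G x)^2 * ?p
      + 12 * \<delta>^2 * (12 * ?w^2 * Y x - G x * Y' x) / (G x * Y x) * ?q"
    using ne unfolding S1_def X1_def X2_def Let_def Y_relations
    by (simp_all add: axis_def field_simps eval_nat_numeral)
  have dr: "dd r x (S1 \<alpha> \<beta> g3 \<delta> x) = - 8 * \<delta>^2 * n x"
    using ne by (simp add: dd_r v n_def field_simps power2_eq_square)
  have dn: "dd n x (S1 \<alpha> \<beta> g3 \<delta> x) = - 8 * \<delta>^2 * e x"
    using ne by (simp add: dd_n assms v e_def field_simps power2_eq_square power3_eq_cube)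
  have Y': "?w * Y' x = Y x + \<beta> * G x / 2"
    using Y_relations(1)[of x] by (simp add: algebra_simps)
  \<comment> \<open>The last factor is zero by the preceding relation; factoring it out keeps the
    rational identity small.\<close>
  have "dd e x (S1 \<alpha> \<beta> g3 \<delta> x)
    = 24 * \<delta>^2 * ?w * ?p / (Y x)^2 * (?w * Y' x - Y x - \<beta> * G x / 2)"
    using ne by (simp add: dd_e assms v field_simps eval_nat_numeral)
  then have de: "dd e x (S1 \<alpha> \<beta> g3 \<delta> x) = 0" by (simp add: Y')
  have "dd k x (S1 \<alpha> \<beta> g3 \<delta> x)
    = 8 * \<delta>^2 * ?p / (Y x)^2 * (?w * Y' x - Y x - \<beta> * G x / 2) - 16 * \<delta>^2 * ?w / G x * ((G x)^2 * ?q / (Y x)^3)"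
    using ne by (simp add: dd_k assms v field_simps eval_nat_numeral)
  then have dk: "dd k x (S1 \<alpha> \<beta> g3 \<delta> x) = - 16 * \<delta>^2 * ?w / G x * (e x - 3 * ?w * k x)"
    unfolding e_minus_k[OF assms] by (simp add: Y')
  have v3: "S1 \<alpha> \<beta> g3 \<delta> x $ 3 = - 8 * \<delta>^2 * (e x - 3 * ?w * k x)^2"
    unfolding e_minus_k[OF assms, symmetric] v using ne by (simp add: field_simps eval_nat_numeral)
  have "dd Q x (S1 \<alpha> \<beta> g3 \<delta> x) = 0"
    using ne by (simp add: dd_Q assms v(1) v3 dk dn de) (simp add: field_simps eval_nat_numeral)
  with v(1) dr dn de show ?thesis by (simp add: coord_derivs_def)
qed

lemma coord_derivs_S2:
  assumes "x \<in> U"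
  shows "coord_derivs x (S2 \<alpha> \<beta> g3 \<delta> x)
    = (0, 0, 0, 1 / (4 * \<delta>), (- 2 * n x + 2 * x $ 1 * e x) / \<delta>)"
proof -
  note ne = Y_ne[OF assms] G_ne[OF assms] \<delta>
  have v: "S2 \<alpha> \<beta> g3 \<delta> x $ 1 = 0" "S2 \<alpha> \<beta> g3 \<delta> x $ 2 = 0" "S2 \<alpha> \<beta> g3 \<delta> x $ 3 = 0"
    "S2 \<alpha> \<beta> g3 \<delta> x $ 4 = 0" "S2 \<alpha> \<beta> g3 \<delta> x $ 5 = (Y x)^3 / (4 * \<delta> * (G x)^2)"
    by (simp_all add: S2_def X1_def axis_def Let_def)
  show ?thesis
    using ne by (simp add: coord_derivs_def dd_r dd_n dd_e dd_Q dd_k assms v) (simp add: field_simps)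
qed

lemma coord_derivs_Z1:
  assumes "x \<in> U"
  shows "coord_derivs x (Z1 \<alpha> \<beta> g3 \<delta> x) = (0, - 2 * \<delta> * x $ 1, \<delta>, 0, 16 * \<delta> * e x)"
proof -
  note ne = Y_ne[OF assms] G_ne[OF assms] \<delta>
  let ?w = "x $ 1" and ?y = "x $ 2" and ?p = "x $ 4" and ?q = "x $ 5"
  have v: "Z1 \<alpha> \<beta> g3 \<delta> x $ 1 = 0" "Z1 \<alpha> \<beta> g3 \<delta> x $ 2 = - 2 * \<delta> * ?w / Y x"
    "Z1 \<alpha> \<beta> g3 \<delta> x $ 3 = 4 * \<delta> * ((G x)^2 * ?q / (Y x)^3)"
    "Z1 \<alpha> \<beta> g3 \<delta> x $ 4 = \<delta> * (Y x + ?w * Y' x) / G x"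
    "Z1 \<alpha> \<beta> g3 \<delta> x $ 5 = - 12 * \<delta> * (Y x)^3 * ?w^2 / (G x)^3"
    using ne unfolding Z1_def Let_def Y_relations by (simp_all add: axis_def field_simps)
  have Y': "?w * Y' x = Y x + \<beta> * G x / 2"
    using Y_relations(1)[of x] by (simp add: algebra_simps)
  have dr: "dd r x (Z1 \<alpha> \<beta> g3 \<delta> x) = - 2 * \<delta> * ?w"
    using ne by (simp add: dd_r v)
  have dn: "dd n x (Z1 \<alpha> \<beta> g3 \<delta> x) = \<delta>"
    using ne by (simp add: dd_n assms v field_simps)
  have "dd e x (Z1 \<alpha> \<beta> g3 \<delta> x) = 6 * \<delta> * ?w^2 / (G x * Y x) * (?w * Y' x - Y x - \<beta> * G x / 2)"
    using ne by (simp add: dd_e assms v field_simps eval_nat_numeral)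
  then have de: "dd e x (Z1 \<alpha> \<beta> g3 \<delta> x) = 0" by (simp add: Y')
  have "dd k x (Z1 \<alpha> \<beta> g3 \<delta> x) = 2 * \<delta> * ?w / (Y x * G x) * (Y x + ?w * Y' x - \<beta> * G x / 2)"
    using ne by (simp add: dd_k assms v field_simps eval_nat_numeral)
  then have dk: "dd k x (Z1 \<alpha> \<beta> g3 \<delta> x) = 4 * \<delta> * ?w / G x"
    using ne by (simp add: Y')
  have "dd Q x (Z1 \<alpha> \<beta> g3 \<delta> x) = 16 * \<delta> * e x"
    using ne by (simp add: dd_Q assms v(1) v(3)[unfolded e_minus_k[OF assms]] dk dn de)
      (simp add: field_simps eval_nat_numeral)
  with v(1) dr dn de show ?thesis by (simp add: coord_derivs_def)
qed

lemma c_eq: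
  assumes "x \<in> U"
  shows "c1 \<alpha> \<beta> g3 \<delta> x = (4 * (x $ 1)^2 * e x - 3 * r x - 2 * x $ 1 * n x) / (8 * \<delta>^3)"
    and "c2 \<alpha> \<beta> g3 x = Q x - 8 * n x * e x + 8 * x $ 1 * (e x)^2"
    and "c3 \<alpha> \<beta> g3 \<delta> x = (n x - x $ 1 * e x) / \<delta>"
proof -
  note ne = Y_ne[OF assms] G_ne[OF assms] \<delta>
  \<comment> \<open>With \<open>P\<close> and \<open>R\<close> replacing \<open>p\<close> and
    \<open>q\<close>, the functions \<open>n\<close>, \<open>e\<close>, \<open>k\<close> and all
    three coefficients are polynomial up to powers of \<open>\<delta>\<close>, so the claims become
    polynomial identities.\<close>
  define P where "P = x $ 4 / Y x"
  define R where "R = (G x)^2 * x $ 5 / (Y x)^3"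
  have n: "n x = Y' x * x $ 2 / 2 + G x * P" and e: "e x = R + 6 * (x $ 1)^2 * P + 3/2 * \<beta> * x $ 1 * x $ 2"
    and k: "k x = 2 * x $ 1 * P + \<beta> * x $ 2 / 2"
    by (simp_all add: n_def e_def k_def P_def R_def)
  have YG: "Y x = \<alpha> * x $ 1 + \<beta> * ((x $ 1)^3 + g3 / 2)" "G x = 4 * (x $ 1)^3 - g3" "Y' x = \<alpha> + 3 * \<beta> * (x $ 1)^2"
    by (simp_all add: Yf_def Gf_def Y'_def Let_def)
  have "c1 \<alpha> \<beta> g3 \<delta> x = (- 2 * (\<alpha> * x $ 1 + 3 * g3 / 8 * \<beta>) * x $ 2 + (8 * (x $ 1)^3 + g3) * x $ 1 * P
      + 2 * (x $ 1)^2 * R) / (4 * \<delta>^3)"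
    using ne unfolding c1_def Let_def P_def R_def by (simp add: field_simps eval_nat_numeral)
  also have "\<dots> = (4 * (x $ 1)^2 * e x - 3 * r x - 2 * x $ 1 * n x) / (8 * \<delta>^3)"
    using ne(3) unfolding n e r_def YG by (simp add: field_simps eval_nat_numeral)
  finally show "c1 \<alpha> \<beta> g3 \<delta> x = (4 * (x $ 1)^2 * e x - 3 * r x - 2 * x $ 1 * n x) / (8 * \<delta>^3)" .
  have "c2 \<alpha> \<beta> g3 x = 6 * x $ 3 - 12 * \<beta> * (\<alpha> * x $ 1 + 3 * g3 * \<beta> / 16) * (x $ 2)^2
      + 12 * (x $ 1)^2 * (16 * (x $ 1)^3 + 5 * g3) * P^2 + 12 * x $ 1 * R^2
      + 6 * x $ 1 * (\<beta> * (8 * (x $ 1)^3 + g3) - 8 * \<alpha> * x $ 1) * x $ 2 * P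
      - 4 * (2 * \<alpha> - 3 * \<beta> * (x $ 1)^2) * x $ 2 * R + 16 * (5 * (x $ 1)^3 + g3) * P * R"
    unfolding c2_def Let_def P_def R_def by (simp add: field_simps eval_nat_numeral)
  also have "\<dots> = Q x - 8 * n x * e x + 8 * x $ 1 * (e x)^2"
    unfolding Q_def n e k YG by (simp add: field_simps eval_nat_numeral)
  finally show "c2 \<alpha> \<beta> g3 x = Q x - 8 * n x * e x + 8 * x $ 1 * (e x)^2" .
  have "c3 \<alpha> \<beta> g3 \<delta> x = (\<alpha> / 2 * x $ 2 - (2 * (x $ 1)^3 + g3) * P - x $ 1 * R) / \<delta>"
    using ne unfolding c3_def Let_def P_def R_def by (simp add: field_simps eval_nat_numeral)
  also have "\<dots> = (n x - x $ 1 * e x) / \<delta>"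
    using ne(3) unfolding n e YG by (simp add: field_simps eval_nat_numeral)
  finally show "c3 \<alpha> \<beta> g3 \<delta> x = (n x - x $ 1 * e x) / \<delta>" .
qed

lemma coord_derivs_S3:
  assumes "x \<in> U"
  shows "coord_derivs x (S3 \<alpha> \<beta> g3 \<delta> x)
    = ((4 * (x $ 1)^2 * e x - 3 * r x - 2 * x $ 1 * n x) / (2 * \<delta>),
       (n x * (4 * (x $ 1)^2 * e x - 3 * r x - 2 * x $ 1 * n x) + 2 * x $ 1 * (n x - x $ 1 * e x)^2) / \<delta>,
       (e x * (4 * (x $ 1)^2 * e x - 3 * r x - 2 * x $ 1 * n x) - (n x - x $ 1 * e x)^2) / \<delta>,
       (Q x - 8 * n x * e x + 8 * x $ 1 * (e x)^2) / (4 * \<delta>),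
       ((Q x - 8 * n x * e x + 8 * x $ 1 * (e x)^2) * (- 2 * n x + 2 * x $ 1 * e x)
        - 16 * e x * (n x - x $ 1 * e x)^2) / \<delta>)"
proof -
  let ?c1 = "c1 \<alpha> \<beta> g3 \<delta> x" and ?c2 = "c2 \<alpha> \<beta> g3 x" and ?c3 = "c3 \<alpha> \<beta> g3 \<delta> x"
  have lin: "dd f x (S3 \<alpha> \<beta> g3 \<delta> x)
    = - ?c1 * dd f x (S1 \<alpha> \<beta> g3 \<delta> x) + ?c2 * dd f x (S2 \<alpha> \<beta> g3 \<delta> x) - ?c3^2 * dd f x (Z1 \<alpha> \<beta> g3 \<delta> x)"
    if "regular U f" for f
  proof -
    have l: "linear (dd f x)"
      using regular_differentiable[OF open_U that assms] by (rule linear_frechet_derivative)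
    show ?thesis
      unfolding S3_def linear_diff[OF l] linear_add[OF l] regular_derivative_scale[OF open_U that assms] ..
  qed
  have lin1: "S3 \<alpha> \<beta> g3 \<delta> x $ 1
    = - ?c1 * S1 \<alpha> \<beta> g3 \<delta> x $ 1 + ?c2 * S2 \<alpha> \<beta> g3 \<delta> x $ 1 - ?c3^2 * Z1 \<alpha> \<beta> g3 \<delta> x $ 1"
    by (simp add: S3_def)
  show ?thesis
    using coord_derivs_S1[OF assms] coord_derivs_S2[OF assms] coord_derivs_Z1[OF assms] \<delta>
    unfolding coord_derivs_def
    by (simp add: lin lin1 regular_coords c_eq assms) (simp add: field_simps eval_nat_numeral)
qed

section \<open>Relating the generators to derivations\<close>

lemma relatedI:
  assumes "regular_field U X"
    and "\<And>x. x \<in> U \<Longrightarrow> frechet_derivative psi (at x) (X x) = zorn_scale (zlead (D (psi x))) (psi x) - D (psi x)"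
  shows "related U psi (restrict_to U X) D"
  using assms unfolding related_def regular_field_def vf_apply_def restrict_to_def
  by (auto elim!: regular.cong)

lemma regular_fieldI:
  assumes "regular U (\<lambda>x. X x $ 1)" "regular U (\<lambda>x. X x $ 2)" "regular U (\<lambda>x. X x $ 3)"
    "regular U (\<lambda>x. X x $ 4)" "regular U (\<lambda>x. X x $ 5)"
  shows "regular_field U X"
  unfolding regular_field_def forall_5 using assms by blast

lemma regular_field_X: "regular_field U X1" "regular_field U (X2 \<alpha> \<beta> g3)"
  unfolding X1_def[abs_def] X2_def[abs_def] Let_def
  by (rule regular_fieldI; simp add: axis_def; intro regular_intros regular_YG; simp add: Y_ne G_ne)+

lemma regular_field_scale: "regular U f \<Longrightarrow> regular_field U X \<Longrightarrow> regular_field U (\<lambda>x. f x *s X x)"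
  by (simp add: regular_field_def regular.mult)

lemma regular_field_add: "regular_field U X \<Longrightarrow> regular_field U Z \<Longrightarrow> regular_field U (\<lambda>x. X x + Z x)"
  by (simp add: regular_field_def regular.add)

lemma regular_field_diff: "regular_field U X \<Longrightarrow> regular_field U Z \<Longrightarrow> regular_field U (\<lambda>x. X x - Z x)"
  by (simp add: regular_field_def regular_diff)

lemma regular_field_S:
  "regular_field U (S1 \<alpha> \<beta> g3 \<delta>)" "regular_field U (S2 \<alpha> \<beta> g3 \<delta>)" "regular_field U (S3 \<alpha> \<beta> g3 \<delta>)"
proof -
  show S: "regular_field U (S1 \<alpha> \<beta> g3 \<delta>)" "regular_field U (S2 \<alpha> \<beta> g3 \<delta>)"
    unfolding S1_def[abs_def] S2_def[abs_def] Let_def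
    by (intro regular_field_diff regular_field_scale regular_field_X regular_intros regular_YG;
        simp add: Y_ne G_ne \<delta>)+
  have Z: "regular_field U (Z1 \<alpha> \<beta> g3 \<delta>)"
    unfolding Z1_def[abs_def] Let_def
    by (rule regular_fieldI; simp add: axis_def; intro regular_intros regular_YG; simp add: Y_ne G_ne)
  have c: "regular U (c1 \<alpha> \<beta> g3 \<delta>)" "regular U (c2 \<alpha> \<beta> g3)" "regular U (c3 \<alpha> \<beta> g3 \<delta>)"
    unfolding c1_def[abs_def] c2_def[abs_def] c3_def[abs_def] Let_def
    by (intro regular_intros regular_YG; simp add: Y_ne \<delta>)+
  show "regular_field U (S3 \<alpha> \<beta> g3 \<delta>)"
    unfolding S3_def[abs_def]
    by (intro regular_field_diff regular_field_add regular_field_scale S Z regular_intros regular_minus c)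
qed

text \<open>The scalars can be read from the entries \<open>- w\<close> and \<open>2 * e\<close> of
  \<open>psi\<close>: \<open>S1\<close> moves \<open>w\<close> at rate
  \<open>- 4 * \<delta>^2\<close>, \<open>S2\<close> moves \<open>e\<close> at rate
  \<open>1 / (4 * \<delta>)\<close>, and \<open>S3\<close> moves \<open>w\<close> at rate
  \<open>(4 * w^2 * e - 3 * r - 2 * w * n) / (2 * \<delta>)\<close>.\<close>

lemma related_S:
  "related U psi (restrict_to U (S1 \<alpha> \<beta> g3 \<delta>)) (der 0 (axis 2 (4 * \<delta>^2)) 0)"
  "related U psi (restrict_to U (S2 \<alpha> \<beta> g3 \<delta>)) (der 0 (axis 3 (- 1 / (2 * \<delta>))) 0)"
  "related U psi (restrict_to U (S3 \<alpha> \<beta> g3 \<delta>)) (der 0 (axis 1 (1 / (2 * \<delta>))) 0)"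
proof -
  note der = psi_def der.simps zlead_def vec3_simps axis_def zero_prod_def
  show "related U psi (restrict_to U (S1 \<alpha> \<beta> g3 \<delta>)) (der 0 (axis 2 (4 * \<delta>^2)) 0)"
  proof (rule relatedI[OF regular_field_S(1)])
    show "frechet_derivative psi (at x) (S1 \<alpha> \<beta> g3 \<delta> x) = zorn_scale
      (zlead (der 0 (axis 2 (4 * \<delta>^2)) 0 (psi x))) (psi x) - der 0 (axis 2 (4 * \<delta>^2)) 0 (psi x)"
      if "x \<in> U" for x
      using coord_derivs_S1[OF that] unfolding coord_derivs_def dd_psi[OF that]
      by (simp add: der) (simp add: algebra_simps)
  qed
  show "related U psi (restrict_to U (S2 \<alpha> \<beta> g3 \<delta>)) (der 0 (axis 3 (- 1 / (2 * \<delta>))) 0)"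
  proof (rule relatedI[OF regular_field_S(2)])
    show "frechet_derivative psi (at x) (S2 \<alpha> \<beta> g3 \<delta> x) = zorn_scale
      (zlead (der 0 (axis 3 (- 1 / (2 * \<delta>))) 0 (psi x))) (psi x) - der 0 (axis 3 (- 1 / (2 * \<delta>))) 0 (psi x)"
      if "x \<in> U" for x
      using coord_derivs_S2[OF that] \<delta> unfolding coord_derivs_def dd_psi[OF that]
      by (simp add: der) (simp add: field_simps)
  qed
  show "related U psi (restrict_to U (S3 \<alpha> \<beta> g3 \<delta>)) (der 0 (axis 1 (1 / (2 * \<delta>))) 0)"
  proof (rule relatedI[OF regular_field_S(3)])
    show "frechet_derivative psi (at x) (S3 \<alpha> \<beta> g3 \<delta> x) = zorn_scale
      (zlead (der 0 (axis 1 (1 / (2 * \<delta>))) 0 (psi x))) (psi x) - der 0 (axis 1 (1 / (2 * \<delta>))) 0 (psi x)"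
      if "x \<in> U" for x
      using coord_derivs_S3[OF that] \<delta> unfolding coord_derivs_def dd_psi[OF that]
      by (simp add: der) (simp add: field_simps eval_nat_numeral)
  qed
qed

lemma g2_chart_psi: "g2_chart U psi"
proof
  show "open U" by (rule open_U)
  show "regular_zorn U psi" by (rule regular_zorn_psi)
  show "v = 0" if "x \<in> U" "frechet_derivative psi (at x) v = 0" for x v
    using that by (rule psi_immersion)
  have scale: "\<exists>X. related U psi X (der 0 (axis i 1) 0)"
    if "related U psi X (der 0 (axis i c) 0)" "c \<noteq> 0" for X and i :: 3 and c
  proof -
    have "mat_scale (inverse c) 0 = (0 :: 'a^3^3)" "inverse c *s axis i c = axis i 1"
      using that(2) by (simp_all add: vec_eq_iff axis_def)
    with related_scale[OF open_U regular_zorn_psi that(1), of "inverse c"] show ?thesis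
      by (auto simp: end_scale_der)
  qed
  show "\<exists>X. related U psi X (der 0 (axis i 1) 0)" for i
    using exhaust_3[of i] scale[OF related_S(1)] scale[OF related_S(2)] scale[OF related_S(3)] \<delta> by auto
  show "\<not> related U psi (\<lambda>_. 0) (der 0 (axis 2 1) 0)"
  proof
    \<comment> \<open>At any point the third entry of \<open>cross_prod (axis 2 1) u\<close> is
      minus the leading coordinate of \<open>psi\<close>, that is -1, whereas a zero field would
      force it to be 0.\<close>
    assume rel: "related U psi (\<lambda>_. 0) (der 0 (axis 2 1) 0)"
    obtain x where x: "x \<in> U" using U_ne by blast
    have "frechet_derivative psi (at x) 0 = 0"
      by (rule linear_0[OF linear_frechet_derivative[OF regular_zorn_differentiable[OF open_U regular_zorn_psi x]]])
    with rel x show False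
      by (auto simp: related_def vf_apply_def psi_def zlead_def vec3_simps axis_def zero_prod_def)
  qed
qed

lemma pairwise_bracket_generates_S:
  "pairwise_bracket_generates_split_g2 U (restrict_to U (S1 \<alpha> \<beta> g3 \<delta>))
    (restrict_to U (S2 \<alpha> \<beta> g3 \<delta>)) (restrict_to U (S3 \<alpha> \<beta> g3 \<delta>))"
proof -
  interpret g2_chart U psi by (rule g2_chart_psi)
  have "4 * \<delta>^2 * (- 1 / (2 * \<delta>)) * (1 / (2 * \<delta>)) = - 1"
    using \<delta> by (simp add: field_simps power2_eq_square)
  from pairwise_bracket_generates[OF this] show ?thesis
    by (simp only: related_S[THEN fld_eqI])
qed

end

section \<open>The (2,3,5)-distribution\<close>

lemma vec_span_2: "v \<in> vec.span {a, b} \<longleftrightarrow> (\<exists>s t. v = s *s a + t *s b)"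
  by (simp add: vec.span_breakdown_eq algebra_simps eq_diff_eq)

lemma vec_span_3: "v \<in> vec.span {a, b, c} \<longleftrightarrow> (\<exists>s t u. v = s *s a + t *s b + u *s c)"
proof -
  have "v \<in> vec.span {a, b, c} \<longleftrightarrow> (\<exists>s. v - s *s a \<in> vec.span {b, c})"
    by (rule vec.span_breakdown_eq)
  also have "\<dots> \<longleftrightarrow> (\<exists>s t u. v = s *s a + t *s b + u *s c)"
    unfolding vec_span_2 by (simp add: diff_eq_eq add.commute add.left_commute)
  finally show ?thesis .
qed

lemma axis_nth: "axis i a $ j = (if j = i then a else 0)"
  by (simp add: axis_def)

lemma smooth_vfield_differentiable: "smooth_vfield U X \<Longrightarrow> x \<in> U \<Longrightarrow> X differentiable (at x)"
  by (erule smooth_vfield.cases) blast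

context monge_domain
begin

text \<open>\<open>\<kappa>\<close> is the \<open>w\<close>-component of \<open>X2\<close>,
  \<open>m\<close> its reciprocal, and \<open>c\<close> the coefficient of \<open>q^2\<close> in its
  \<open>z\<close>-component; all three depend on \<open>w\<close> alone.\<close>

definition \<kappa> :: "'a^5 \<Rightarrow> 'a" where "\<kappa> x = (Y x)^2 / (2 * G x)"
definition m :: "'a^5 \<Rightarrow> 'a" where "m x = 2 * G x / (Y x)^2"
definition c :: "'a^5 \<Rightarrow> 'a" where "c x = (G x)^3 / (Y x)^4"

lemma m_\<kappa>: "x \<in> U \<Longrightarrow> m x * \<kappa> x = 1" and \<kappa>_ne: "x \<in> U \<Longrightarrow> \<kappa> x \<noteq> 0" and c_ne: "x \<in> U \<Longrightarrow> c x \<noteq> 0"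
  using Y_ne[of x] G_ne[of x] by (simp_all add: m_def \<kappa>_def c_def)

lemma regular_\<kappa>mc: "regular U \<kappa>" "regular U m" "regular U c"
  unfolding \<kappa>_def m_def c_def by (intro regular_intros regular_YG; simp add: Y_ne G_ne)+

lemma dd_\<kappa>mc:
  assumes "x \<in> U"
  shows "dd \<kappa> x v = dd \<kappa> x (axis 1 1) * v $ 1" "dd m x v = dd m x (axis 1 1) * v $ 1"
    "dd c x v = dd c x (axis 1 1) * v $ 1"
proof -
  have *: "\<exists>a. \<forall>v. dd Y x v = a * v $ 1" "\<exists>a. \<forall>v. dd G x v = a * v $ 1"
    by (auto simp: has_derivative_YG[THEN frechet_derivative_eqI])
  have lin: "dd f x v = dd f x (axis 1 1) * v $ 1" if "\<exists>a. \<forall>v. dd f x v = a * v $ 1" for f v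
    using that by (auto simp: axis_def)
  have diff: "Y differentiable (at x)" "G differentiable (at x)"
    using regular_differentiable[OF open_U _ assms] regular_YG by auto
  note ne = Y_ne[OF assms] G_ne[OF assms]
  have p: "(\<lambda>x. f x ^ k) differentiable (at x)" if "f differentiable (at x)" for f :: "'a^5 \<Rightarrow> 'a" and k
    using that by (rule differentiable_power)
  show "dd \<kappa> x v = dd \<kappa> x (axis 1 1) * v $ 1" "dd m x v = dd m x (axis 1 1) * v $ 1"
    "dd c x v = dd c x (axis 1 1) * v $ 1"
    unfolding \<kappa>_def[abs_def] m_def[abs_def] c_def[abs_def]
    using ne by (simp_all add: frechet_derivative_divide frechet_derivative_mult frechet_derivative_power
        diff p differentiable_mult frechet_derivative_const lin[OF *(1), of v] lin[OF *(2), of v])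
      (simp_all add: field_simps)
qed

lemma X1_nth: "X1 x $ i = (if i = 5 then 1 else (0 :: 'a))"
  by (simp add: X1_def axis_def)

lemma X2_nth:
  "X2 \<alpha> \<beta> g3 x $ 1 = \<kappa> x" "X2 \<alpha> \<beta> g3 x $ 2 = x $ 4" "X2 \<alpha> \<beta> g3 x $ 3 = c x * (x $ 5)^2"
  "X2 \<alpha> \<beta> g3 x $ 4 = x $ 5" "X2 \<alpha> \<beta> g3 x $ 5 = 0"
  by (simp_all add: X2_def Let_def axis_def \<kappa>_def c_def)

definition X3 :: "'a vfield" where
  "X3 x = (2 * c x * x $ 5) *s d_z + d_p"

lemma X3_nth: "X3 x $ 1 = 0" "X3 x $ 2 = 0" "X3 x $ 3 = 2 * c x * x $ 5" "X3 x $ 4 = 1" "X3 x $ 5 = 0"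
  by (simp_all add: X3_def axis_def)

lemma regular_field_X3: "regular_field U X3"
  by (rule regular_fieldI; simp add: X3_nth; intro regular_intros regular_\<kappa>mc)

lemma lie_bracket_X1:
  assumes "regular_field U Z" "x \<in> U"
  shows "lie_bracket U X1 Z x $ i = dd (\<lambda>x. Z x $ i) x (axis 5 1)"
  using lie_bracket_nth[OF open_U regular_field_X(1) assms]
  by (simp add: vf_apply_def X1_nth frechet_derivative_const X1_def)

lemma dd_fields:
  assumes "x \<in> U"
  shows "dd (\<lambda>x. c x * (x $ 5)^2) x v = dd c x (axis 1 1) * v $ 1 * (x $ 5)^2 + 2 * c x * x $ 5 * v $ 5"
    "dd (\<lambda>x. 2 * c x * x $ 5) x v = 2 * (dd c x (axis 1 1) * v $ 1 * x $ 5 + c x * v $ 5)"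
  using regular_differentiable[OF open_U regular_\<kappa>mc(3) assms]
  by (simp_all add: frechet_derivative_mult frechet_derivative_power differentiable_coord differentiable_mult
      differentiable_power frechet_derivative_const dd_\<kappa>mc(3)[OF assms, of v] algebra_simps power2_eq_square)

lemma lie_bracket_X1_X2: "x \<in> U \<Longrightarrow> lie_bracket U X1 (X2 \<alpha> \<beta> g3) x = X3 x"
  using dd_\<kappa>mc[of x "axis 5 1"]
  by (simp add: vec_eq_iff forall_5 lie_bracket_X1[OF regular_field_X(2)] X2_nth X3_nth dd_fields
      frechet_derivative_const) (simp add: axis_def)

text \<open>The coordinate \<open>q\<close> is used as multiplier because its derivative along
  \<open>X1\<close> is 1: bracketing with \<open>X1\<close> then returns the field \<open>Z\<close>
  itself, up to a known term.\<close>

lemma lie_bracket_X1_scale: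
  assumes "regular_field U Z" "x \<in> U"
  shows "lie_bracket U X1 (\<lambda>x. x $ 5 *s Z x) x = Z x + x $ 5 *s lie_bracket U X1 Z x"
proof -
  have diff: "(\<lambda>x. Z x $ i) differentiable (at x)" for i
    using assms regular_differentiable[OF open_U] by (auto simp: regular_field_def)
  have "regular_field U (\<lambda>x. x $ 5 *s Z x)"
    by (intro regular_field_scale regular_intros assms)
  then show ?thesis
    using assms by (simp add: vec_eq_iff lie_bracket_X1 frechet_derivative_mult differentiable_coord diff)
qed

lemma lie_bracket_X1_X1: "lie_bracket U X1 X1 x = (0 :: 'a^5)"
  by (simp add: lie_bracket_def restrict_to_def)

lemma lie_bracket_X1_X3: "x \<in> U \<Longrightarrow> lie_bracket U X1 X3 x = (2 * c x) *s d_z"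
  by (simp add: vec_eq_iff forall_5 lie_bracket_X1[OF regular_field_X3] X3_nth dd_fields
      frechet_derivative_const axis_def)

lemma lie_bracket_X2_X3:
  "x \<in> U \<Longrightarrow> lie_bracket U (X2 \<alpha> \<beta> g3) X3 x = (2 * dd c x (axis 1 1) * \<kappa> x * x $ 5) *s d_z - d_y"
  using dd_\<kappa>mc(1)[of x "X3 x"]
  by (simp add: vec_eq_iff forall_5 lie_bracket_nth[OF open_U regular_field_X(2) regular_field_X3] vf_apply_def
      X2_nth X3_nth dd_fields frechet_derivative_const axis_def)

section \<open>The derived flag of the distribution\<close>

abbreviation D :: "'a^5 \<Rightarrow> ('a^5) set" where "D \<equiv> DX \<alpha> \<beta> g3"

lemma DX_annihilated:
  assumes "x \<in> U" "v \<in> D x"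
  shows "\<omega>1 \<alpha> \<beta> g3 x v = 0" "\<omega>2 \<alpha> \<beta> g3 x v = 0" "\<omega>3 \<alpha> \<beta> g3 x v = 0"
  using assms(2) Y_ne[OF assms(1)] G_ne[OF assms(1)]
  by (auto simp: DX_def vec_span_2 \<omega>1_def \<omega>2_def \<omega>3_def Let_def X1_nth X2_nth \<kappa>_def c_def
      field_simps eval_nat_numeral)

lemma D_nth:
  assumes "x \<in> U" "v \<in> D x"
  shows "v $ 2 = x $ 4 * m x * v $ 1" "v $ 3 = c x * (x $ 5)^2 * m x * v $ 1" "v $ 4 = x $ 5 * m x * v $ 1"
  using assms(2) m_\<kappa>[OF assms(1)] by (auto simp: DX_def vec_span_2 X1_nth X2_nth algebra_simps)

text \<open>The first and fifth components of a section determine the others by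
  \<open>D_nth\<close>. Differentiating these relations expresses the bracket through its own first
  and fifth components and the values of the two sections.\<close>

lemma lie_bracket_sections:
  assumes X: "X \<in> sections U D" and Z: "Z \<in> sections U D" and x: "x \<in> U"
  shows "lie_bracket U X Z x \<in> vec.span {X1 x, X2 \<alpha> \<beta> g3 x, X3 x}"
proof -
  have diff: "W differentiable (at x)" "(\<lambda>x. W x $ i) differentiable (at x)" if "W \<in> sections U D" for W i
  proof -
    show W: "W differentiable (at x)"
      using that smooth_vfield_differentiable[OF _ x] by (simp add: sections_def)
    show "(\<lambda>x. W x $ i) differentiable (at x)"
      using bounded_linear.has_derivative[OF bounded_linear_vec_nth] W unfolding differentiable_def by blast
  qed
  note reg_diff = regular_differentiable[OF open_U _ x]
  define a where "a = dd m x (axis 1 1)"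
  define b where "b = dd c x (axis 1 1)"
  have d: "dd (\<lambda>x. W x $ 2) x v = v $ 4 * m x * W x $ 1 + x $ 4 * a * v $ 1 * W x $ 1
       + x $ 4 * m x * dd (\<lambda>x. W x $ 1) x v"
    "dd (\<lambda>x. W x $ 4) x v = v $ 5 * m x * W x $ 1 + x $ 5 * a * v $ 1 * W x $ 1
       + x $ 5 * m x * dd (\<lambda>x. W x $ 1) x v"
    "dd (\<lambda>x. W x $ 3) x v = b * v $ 1 * (x $ 5)^2 * m x * W x $ 1 + 2 * c x * x $ 5 * v $ 5 * m x * W x $ 1
       + c x * (x $ 5)^2 * a * v $ 1 * W x $ 1 + c x * (x $ 5)^2 * m x * dd (\<lambda>x. W x $ 1) x v"
    if W: "W \<in> sections U D" for W v
  proof -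
    have D: "W y \<in> D y" if "y \<in> U" for y
      using W that by (simp add: sections_def)
    have "dd (\<lambda>x. W x $ 2) x v = dd (\<lambda>x. x $ 4 * m x * W x $ 1) x v"
      "dd (\<lambda>x. W x $ 4) x v = dd (\<lambda>x. x $ 5 * m x * W x $ 1) x v"
      "dd (\<lambda>x. W x $ 3) x v = dd (\<lambda>x. c x * (x $ 5)^2 * m x * W x $ 1) x v"
      by (simp_all add: frechet_derivative_cong_open[OF open_U x D_nth(1)[OF _ D]]
          frechet_derivative_cong_open[OF open_U x D_nth(2)[OF _ D]]
          frechet_derivative_cong_open[OF open_U x D_nth(3)[OF _ D]])
    then show "dd (\<lambda>x. W x $ 2) x v = v $ 4 * m x * W x $ 1 + x $ 4 * a * v $ 1 * W x $ 1
       + x $ 4 * m x * dd (\<lambda>x. W x $ 1) x v"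
    "dd (\<lambda>x. W x $ 4) x v = v $ 5 * m x * W x $ 1 + x $ 5 * a * v $ 1 * W x $ 1
       + x $ 5 * m x * dd (\<lambda>x. W x $ 1) x v"
    "dd (\<lambda>x. W x $ 3) x v = b * v $ 1 * (x $ 5)^2 * m x * W x $ 1 + 2 * c x * x $ 5 * v $ 5 * m x * W x $ 1
       + c x * (x $ 5)^2 * a * v $ 1 * W x $ 1 + c x * (x $ 5)^2 * m x * dd (\<lambda>x. W x $ 1) x v"
      using diff(2)[OF W] reg_diff[OF regular_\<kappa>mc(2)] reg_diff[OF regular_\<kappa>mc(3)]
      by (simp_all add: frechet_derivative_mult frechet_derivative_power differentiable_coord differentiable_mult
          differentiable_power dd_\<kappa>mc(2,3)[OF x, of v] a_def b_def algebra_simps)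
  qed
  let ?B = "lie_bracket U X Z x"
  have B: "?B $ i = dd (\<lambda>x. Z x $ i) x (X x) - dd (\<lambda>x. X x $ i) x (Z x)" for i
    using x by (simp add: lie_bracket_def restrict_to_def frechet_derivative_nth diff(1)[OF X] diff(1)[OF Z])
  have "X x \<in> D x" "Z x \<in> D x" using X Z x by (simp_all add: sections_def)
  note nth = D_nth[OF x this(1)] D_nth[OF x this(2)]
  \<comment> \<open>The coefficient of \<open>X3\<close>: a section \<open>W\<close> equals
    \<open>W5 * X1 + m * W1 * X2\<close>, and this is the determinant of the coefficients of the two
    sections.\<close>
  let ?s = "m x * (X x $ 5 * Z x $ 1 - Z x $ 5 * X x $ 1)"
  have "?B $ 2 = x $ 4 * m x * ?B $ 1" "?B $ 4 = ?s + x $ 5 * m x * ?B $ 1"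
    "?B $ 3 = 2 * c x * x $ 5 * ?s + c x * (x $ 5)^2 * m x * ?B $ 1"
    by (simp_all add: B d X Z nth algebra_simps)
  then have "?B = ?B $ 5 *s X1 x + (m x * ?B $ 1) *s X2 \<alpha> \<beta> g3 x + ?s *s X3 x"
    using m_\<kappa>[OF x] by (simp add: vec_eq_iff forall_5 X1_nth X2_nth X3_nth algebra_simps)
  then show ?thesis unfolding vec_span_3 by blast
qed

lemma sections_D:
  "X1 \<in> sections U D" "X2 \<alpha> \<beta> g3 \<in> sections U D"
  "(\<lambda>x. x $ 5 *s X1 x) \<in> sections U D" "(\<lambda>x. x $ 5 *s X2 \<alpha> \<beta> g3 x) \<in> sections U D"
  unfolding sections_def DX_def
  by (simp_all add: smooth_vfield_regular_field[OF open_U] regular_field_scale regular_field_X regular.coord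
      vec.span_scale vec.span_base)

lemma bracket_distI:
  "X \<in> sections U A \<Longrightarrow> Z \<in> sections U B \<Longrightarrow> lie_bracket U X Z x \<in> bracket_dist U A B x"
  unfolding bracket_dist_def by (blast intro: vec.span_base)

text \<open>As \<open>bracket_dist\<close> spans brackets only, \<open>X1\<close> and
  \<open>X2\<close> have to be recovered as such: \<open>[X1, q X1] = X1\<close> and
  \<open>[X1, q X2] = X2 + q X3\<close>, with \<open>X3 = [X1, X2]\<close>.\<close>

lemma X_in_bracket_dist:
  assumes "sections U D \<subseteq> sections U B" "x \<in> U"
  shows "X1 x \<in> bracket_dist U D B x" "X2 \<alpha> \<beta> g3 x \<in> bracket_dist U D B x" "X3 x \<in> bracket_dist U D B x"
proof -
  note br = bracket_distI[where X = X1 and x = x, OF sections_D(1) subsetD[OF assms(1)]]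
  show X1: "X1 x \<in> bracket_dist U D B x"
    using br[OF sections_D(3)]
    by (simp add: lie_bracket_X1_scale[OF regular_field_X(1) assms(2)] lie_bracket_X1_X1)
  show X3: "X3 x \<in> bracket_dist U D B x"
    using br[OF sections_D(2)] by (simp add: lie_bracket_X1_X2 assms(2))
  have "X2 \<alpha> \<beta> g3 x + x $ 5 *s X3 x \<in> bracket_dist U D B x"
    using br[OF sections_D(4)]
    by (simp add: lie_bracket_X1_scale[OF regular_field_X(2) assms(2)] lie_bracket_X1_X2 assms(2))
  from vec.span_diff[OF this[unfolded bracket_dist_def] vec.span_scale[OF X3[unfolded bracket_dist_def], of "x $ 5"]]
  show "X2 \<alpha> \<beta> g3 x \<in> bracket_dist U D B x"
    by (simp add: bracket_dist_def)
qed

lemma bracket_dist_D: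
  assumes "x \<in> U"
  shows "bracket_dist U D D x = vec.span {X1 x, X2 \<alpha> \<beta> g3 x, X3 x}"
proof
  show "bracket_dist U D D x \<subseteq> vec.span {X1 x, X2 \<alpha> \<beta> g3 x, X3 x}"
    unfolding bracket_dist_def using lie_bracket_sections[OF _ _ assms]
    by (intro vec.span_minimal vec.subspace_span) blast
  show "vec.span {X1 x, X2 \<alpha> \<beta> g3 x, X3 x} \<subseteq> bracket_dist U D D x"
    using X_in_bracket_dist[OF order_refl assms]
    by (intro vec.span_minimal) (auto simp: bracket_dist_def)
qed

lemma sections_bracket_dist:
  "sections U D \<subseteq> sections U (bracket_dist U D D)" "X3 \<in> sections U (bracket_dist U D D)"
proof -
  have "D x \<subseteq> bracket_dist U D D x" if "x \<in> U" for x
    unfolding bracket_dist_D[OF that] DX_def by (rule vec.span_mono) blast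
  then show "sections U D \<subseteq> sections U (bracket_dist U D D)"
    unfolding sections_def by blast
  show "X3 \<in> sections U (bracket_dist U D D)"
    unfolding sections_def
    by (auto simp: bracket_dist_D intro!: smooth_vfield_regular_field[OF open_U] regular_field_X3 vec.span_base)
qed

lemma bracket_dist_D_D:
  assumes x: "x \<in> U"
  shows "bracket_dist U D (bracket_dist U D D) x = UNIV"
proof -
  let ?S = "bracket_dist U D (bracket_dist U D D) x"
  let ?E = "(2 * dd c x (axis 1 1) * \<kappa> x * x $ 5) *s d_z - d_y"
  have sub: "vec.subspace ?S"
    unfolding bracket_dist_def by (rule vec.subspace_span)
  have E: "(2 * c x) *s d_z \<in> ?S" "?E \<in> ?S"
    using bracket_distI[OF sections_D(1) sections_bracket_dist(2), of x]
      bracket_distI[OF sections_D(2) sections_bracket_dist(2), of x]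
    by (simp_all add: lie_bracket_X1_X3 lie_bracket_X2_X3 x)
  have "v \<in> ?S" for v
  proof -
    \<comment> \<open>The coefficients solve a triangular system: \<open>w\<close> is matched by
      \<open>X2\<close>, then \<open>p\<close> by \<open>X3\<close>, then \<open>y\<close> by
      \<open>[X2, X3]\<close>, and finally \<open>z\<close> by \<open>[X1, X3]\<close>.\<close>
    define a where "a = v $ 1 / \<kappa> x"
    define b where "b = v $ 4 - a * x $ 5"
    define d where "d = a * x $ 4 - v $ 2"
    define f where "f = (v $ 3 - a * c x * (x $ 5)^2 - b * 2 * c x * x $ 5
      - d * (2 * dd c x (axis 1 1) * \<kappa> x * x $ 5)) / (2 * c x)"
    have "v = v $ 5 *s X1 x + a *s X2 \<alpha> \<beta> g3 x + b *s X3 x + d *s ?E + f *s ((2 * c x) *s d_z)"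
      using \<kappa>_ne[OF x] c_ne[OF x]
      by (simp add: vec_eq_iff forall_5 X1_nth X2_nth X3_nth axis_nth a_def b_def d_def f_def)
        (simp add: algebra_simps)
    also have "\<dots> \<in> ?S"
      by (intro vec.subspace_add[OF sub] E[THEN vec.subspace_scale[OF sub]]
          X_in_bracket_dist[OF sections_bracket_dist(1) x, THEN vec.subspace_scale[OF sub]])
    finally show ?thesis .
  qed
  then show ?thesis by blast
qed

lemma distribution_235_D: "distribution_235 U D"
  unfolding distribution_235_def
proof (intro ballI conjI)
  fix x assume x: "x \<in> U"
  show "vec.subspace (D x)"
    unfolding DX_def by (rule vec.subspace_span)
  have zero: "c1 = 0 \<and> c2 = 0 \<and> c3 = 0"
    if "c1 *s X1 x + c2 *s X2 \<alpha> \<beta> g3 x + c3 *s X3 x = 0" for c1 c2 c3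
    using that \<kappa>_ne[OF x] by (auto simp: vec_eq_iff forall_5 X1_nth X2_nth X3_nth)
  have ind3: "distinct [X1 x, X2 \<alpha> \<beta> g3 x, X3 x]" "vec.independent (set [X1 x, X2 \<alpha> \<beta> g3 x, X3 x])"
  proof -
    have *: "k i = 0" if "(\<Sum>i<length [X1 x, X2 \<alpha> \<beta> g3 x, X3 x]. k i *s [X1 x, X2 \<alpha> \<beta> g3 x, X3 x] ! i) = 0"
      "i < length [X1 x, X2 \<alpha> \<beta> g3 x, X3 x]" for k i
      using that zero[of "k 0" "k 1" "k 2"] by (auto simp: less_Suc_eq numeral_2_eq_2)
    show "distinct [X1 x, X2 \<alpha> \<beta> g3 x, X3 x]" "vec.independent (set [X1 x, X2 \<alpha> \<beta> g3 x, X3 x])"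
      by (rule vec.independent_list, rule *, assumption+)+
  qed
  then have ind2: "vec.independent {X1 x, X2 \<alpha> \<beta> g3 x}"
    by (intro vec.independent_mono[OF ind3(2)]) auto
  show "vec.dim (D x) = 2"
    using vec.dim_eq_card_independent[OF ind2] ind3(1) by (simp add: DX_def vec.dim_span)
  show "vec.dim (bracket_dist U D D x) = 3"
    using vec.dim_eq_card_independent[OF ind3(2)] ind3(1) by (simp add: bracket_dist_D[OF x] vec.dim_span)
  show "bracket_dist U D (bracket_dist U D D) x = UNIV"
    by (rule bracket_dist_D_D[OF x])
qed

end

theorem corollary5p2:
  fixes \<alpha> \<beta> g3 \<delta> :: "'a::real_normed_field"
    and U :: "('a^5) set"
  assumes "(\<alpha>, \<beta>) \<noteq> (0, 0)" and "\<delta> \<noteq> 0"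
    and "open U" and "U \<noteq> {}"
    and "\<And>x. x \<in> U \<Longrightarrow> Yf \<alpha> \<beta> g3 x \<noteq> 0"
    and "\<And>x. x \<in> U \<Longrightarrow> Gf g3 x \<noteq> 0"
  shows "distribution_235 U (DX \<alpha> \<beta> g3) \<and>
         (\<forall>x\<in>U. \<forall>v\<in>DX \<alpha> \<beta> g3 x. \<omega>1 \<alpha> \<beta> g3 x v = 0 \<and> \<omega>2 \<alpha> \<beta> g3 x v = 0 \<and> \<omega>3 \<alpha> \<beta> g3 x v = 0) \<and>
         pairwise_bracket_generates_split_g2 U
           (restrict_to U (S1 \<alpha> \<beta> g3 \<delta>))
           (restrict_to U (S2 \<alpha> \<beta> g3 \<delta>))
           (restrict_to U (S3 \<alpha> \<beta> g3 \<delta>))"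
proof -
  interpret monge_domain \<alpha> \<beta> g3 \<delta> U
    using assms by unfold_locales
  show ?thesis
    using distribution_235_D DX_annihilated pairwise_bracket_generates_S by blast
qed

end
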